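(* Let $\mathcal{C}$ be a finite set of great circles on the unit sphere $S^2\subset\mathbb{R}^3$ such that the closures of the connected components of $S^2\setminus\bigcup_{C\in\mathcal{C}}C$ are spherical triangles, all congruent to one another. Then for every vertex $v$ (a point lying on at least two circles of $\mathcal{C}$), all the angles at $v$ of the triangles incident to $v$ are equal.
   Context: Two spherical triangles are congruent if one is the image of the other under an isometry of $S^2$. *)

theory Defs
  imports "HOL-Analysis.Analysis"
begin

definition great_circle :: "(real ^ 3) set \<Rightarrow> bool" where
  "great_circle C \<longleftrightarrow> (\<exists>n. n \<noteq> 0 \<and> C = {x \<in> sphere 0 1. n \<bullet> x = 0})"

(* The closed regions cut out by the circles; the closure in R^3 agrees with the closure in
   the sphere because the sphere is closed. *)
definition cells :: "(real ^ 3) set set \<Rightarrow> (real ^ 3) set set" where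
  "cells \<C> = closure ` components (sphere 0 1 - \<Union>\<C>)"

(* The dimension condition says that the points do not lie on a common great circle. *)
definition triangle_corners :: "real ^ 3 \<Rightarrow> real ^ 3 \<Rightarrow> real ^ 3 \<Rightarrow> bool" where
  "triangle_corners a b c \<longleftrightarrow> {a, b, c} \<subseteq> sphere 0 1 \<and> dim {a, b, c} = 3"

(* The central projection to the sphere of the Euclidean triangle abc. *)
definition triangle_region :: "real ^ 3 \<Rightarrow> real ^ 3 \<Rightarrow> real ^ 3 \<Rightarrow> (real ^ 3) set" where
  "triangle_region a b c = {x \<in> sphere 0 1. \<exists>s t u. s \<ge> 0 \<and> t \<ge> 0 \<and> u \<ge> 0 \<and>
      x = s *\<^sub>R a + t *\<^sub>R b + u *\<^sub>R c}"

definition spherical_triangle :: "(real ^ 3) set \<Rightarrow> bool" where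
  "spherical_triangle T \<longleftrightarrow> (\<exists>a b c. triangle_corners a b c \<and> T = triangle_region a b c)"

definition sphere_dist :: "real ^ 3 \<Rightarrow> real ^ 3 \<Rightarrow> real" where
  "sphere_dist x y = arccos (x \<bullet> y)"

definition sphere_isometry :: "(real ^ 3 \<Rightarrow> real ^ 3) \<Rightarrow> bool" where
  "sphere_isometry f \<longleftrightarrow> bij_betw f (sphere 0 1) (sphere 0 1) \<and>
     (\<forall>x \<in> sphere 0 1. \<forall>y \<in> sphere 0 1. sphere_dist (f x) (f y) = sphere_dist x y)"

definition sphere_congruent :: "(real ^ 3) set \<Rightarrow> (real ^ 3) set \<Rightarrow> bool" where
  "sphere_congruent S T \<longleftrightarrow> (\<exists>f. sphere_isometry f \<and> f ` S = T)"

(* For unit vectors v and x with x distinct from v and -v, this is a positive multiple of the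
   initial direction at v of the great-circle arc from v to x. *)
definition tangent_part :: "real ^ 3 \<Rightarrow> real ^ 3 \<Rightarrow> real ^ 3" where
  "tangent_part v x = x - (v \<bullet> x) *\<^sub>R v"

definition corner_angle :: "real ^ 3 \<Rightarrow> real ^ 3 \<Rightarrow> real ^ 3 \<Rightarrow> real" where
  "corner_angle v b c = arccos ((tangent_part v b \<bullet> tangent_part v c) /
     (norm (tangent_part v b) * norm (tangent_part v c)))"

(* The corners b and c are not unique as an ordered pair, but the angle is: has_angle_at_unique. *)
definition has_angle_at :: "(real ^ 3) set \<Rightarrow> real ^ 3 \<Rightarrow> real \<Rightarrow> bool" where
  "has_angle_at T v \<alpha> \<longleftrightarrow> (\<exists>b c. triangle_corners v b c \<and> T = triangle_region v b c \<and>
      \<alpha> = corner_angle v b c)"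

lemma dim3_indep:
  fixes a b c :: "real ^ 3"
  assumes "dim {a, b, c} = 3" "s *\<^sub>R a + t *\<^sub>R b + u *\<^sub>R c = 0"
  shows "s = 0" "t = 0" "u = 0"
proof -
  have key: "s = 0" if d: "dim {a, b, c} = 3" and e: "s *\<^sub>R a + t *\<^sub>R b + u *\<^sub>R c = 0"
    for a b c :: "real ^ 3" and s t u
  proof (rule ccontr)
    assume s: "s \<noteq> 0"
    have "s *\<^sub>R a = (- t) *\<^sub>R b + (- u) *\<^sub>R c"
      using e by (simp add: algebra_simps eq_neg_iff_add_eq_0)
    then have "(1 / s) *\<^sub>R (s *\<^sub>R a) = (1 / s) *\<^sub>R ((- t) *\<^sub>R b + (- u) *\<^sub>R c)" by simp
    then have "a = (1 / s) *\<^sub>R ((- t) *\<^sub>R b + (- u) *\<^sub>R c)" using s by simp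
    moreover have "(1 / s) *\<^sub>R ((- t) *\<^sub>R b + (- u) *\<^sub>R c) \<in> span {b, c}"
      by (intro span_scale span_add span_base) auto
    ultimately have "a \<in> span {b, c}" by simp
    then have "dim {a, b, c} = dim {b, c}" by (simp add: dim_insert)
    also have "\<dots> \<le> card {b, c}" by (rule dim_le_card') simp
    also have "\<dots> \<le> 2" by (simp add: card_insert_if)
    finally show False using d by simp
  qed
  show "s = 0" using key assms by blast
  have "dim {b, a, c} = 3" "t *\<^sub>R b + s *\<^sub>R a + u *\<^sub>R c = 0"
    using assms by (simp_all add: insert_commute add_ac)
  then show "t = 0" using key by blast
  have "dim {c, a, b} = 3" "u *\<^sub>R c + s *\<^sub>R a + t *\<^sub>R b = 0"
    using assms by (simp_all add: insert_commute add_ac)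
  then show "u = 0" using key by blast
qed

lemma corner_angle_commute: "corner_angle v b c = corner_angle v c b"
  by (simp add: corner_angle_def inner_commute mult.commute)

lemma corner_angle_scale:
  assumes "tangent_part v b' = s *\<^sub>R tangent_part v b" "tangent_part v c' = t *\<^sub>R tangent_part v c"
    "s > 0" "t > 0"
  shows "corner_angle v b' c' = corner_angle v b c"
  using assms by (simp add: corner_angle_def)

lemma has_angle_at_unique:
  assumes "has_angle_at T v \<alpha>" "has_angle_at T v \<beta>"
  shows "\<alpha> = \<beta>"
proof -
  obtain b c where bc: "triangle_corners v b c" "T = triangle_region v b c" "\<alpha> = corner_angle v b c"
    using assms(1) unfolding has_angle_at_def by blast
  obtain b' c' where bc': "triangle_corners v b' c'" "T = triangle_region v b' c'"
      "\<beta> = corner_angle v b' c'"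
    using assms(2) unfolding has_angle_at_def by blast
  have vv: "v \<bullet> v = 1"
    using bc(1) by (simp add: triangle_corners_def dot_square_norm)
  have corners: "x \<in> triangle_region v x y" "y \<in> triangle_region v x y"
    if "triangle_corners v x y" for x y
  proof -
    have *: "x \<in> sphere 0 1" "y \<in> sphere 0 1"
      using that unfolding triangle_corners_def by auto
    have "x = 0 *\<^sub>R v + 1 *\<^sub>R x + 0 *\<^sub>R y" by simp
    then have "\<exists>s t u. s \<ge> 0 \<and> t \<ge> 0 \<and> u \<ge> 0 \<and> x = s *\<^sub>R v + t *\<^sub>R x + u *\<^sub>R y"
      by (metis order_refl zero_le_one)
    then show "x \<in> triangle_region v x y"
      using * unfolding triangle_region_def by blast
    have "y = 0 *\<^sub>R v + 0 *\<^sub>R x + 1 *\<^sub>R y" by simp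
    then have "\<exists>s t u. s \<ge> 0 \<and> t \<ge> 0 \<and> u \<ge> 0 \<and> y = s *\<^sub>R v + t *\<^sub>R x + u *\<^sub>R y"
      by (metis order_refl zero_le_one)
    then show "y \<in> triangle_region v x y"
      using * unfolding triangle_region_def by blast
  qed
  have tp: "\<exists>t u. t \<ge> 0 \<and> u \<ge> 0 \<and> tangent_part v z = t *\<^sub>R tangent_part v x + u *\<^sub>R tangent_part v y"
    if zT: "z \<in> triangle_region v x y" for x y z
  proof -
    obtain s t u where "t \<ge> 0" "u \<ge> 0" and z: "z = s *\<^sub>R v + t *\<^sub>R x + u *\<^sub>R y"
      using zT unfolding triangle_region_def by blast
    moreover have "tangent_part v z = t *\<^sub>R tangent_part v x + u *\<^sub>R tangent_part v y"
    proof -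
      have "v \<bullet> z = s + t * (v \<bullet> x) + u * (v \<bullet> y)"
        unfolding z by (simp only: inner_add_right inner_scaleR_right vv mult_1_right)
      then show ?thesis
        unfolding tangent_part_def by (subst (1) z) (simp add: scaleR_add_left scaleR_diff_right)
    qed
    ultimately show ?thesis by blast
  qed
  define B C B' C' where BC: "B = tangent_part v b" "C = tangent_part v c"
    "B' = tangent_part v b'" "C' = tangent_part v c'"
  have ind: "x = 0 \<and> y = 0" if "x *\<^sub>R B + y *\<^sub>R C = 0" for x y
  proof -
    have "(- x * (v \<bullet> b) - y * (v \<bullet> c)) *\<^sub>R v + x *\<^sub>R b + y *\<^sub>R c = 0"
      using that unfolding BC tangent_part_def by (simp add: algebra_simps)
    note * = this
    have "dim {v, b, c} = 3" using bc(1) unfolding triangle_corners_def by blast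
    from dim3_indep(2)[OF this *] dim3_indep(3)[OF this *] show ?thesis ..
  qed
  obtain t u where 1: "t \<ge> 0" "u \<ge> 0" "B' = t *\<^sub>R B + u *\<^sub>R C"
    using tp[of b' b c] corners(1)[OF bc'(1), folded bc'(2), unfolded bc(2)] unfolding BC by blast
  obtain t2 u2 where 2: "t2 \<ge> 0" "u2 \<ge> 0" "C' = t2 *\<^sub>R B + u2 *\<^sub>R C"
    using tp[of c' b c] corners(2)[OF bc'(1), folded bc'(2), unfolded bc(2)] unfolding BC by blast
  obtain q r where 3: "q \<ge> 0" "r \<ge> 0" "B = q *\<^sub>R B' + r *\<^sub>R C'"
    using tp[of b b' c'] corners(1)[OF bc(1), folded bc(2), unfolded bc'(2)] unfolding BC by blast
  obtain q2 r2 where 4: "q2 \<ge> 0" "r2 \<ge> 0" "C = q2 *\<^sub>R B' + r2 *\<^sub>R C'"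
    using tp[of c b' c'] corners(2)[OF bc(1), folded bc(2), unfolded bc'(2)] unfolding BC by blast
  have "(q * t + r * t2 - 1) *\<^sub>R B + (q * u + r * u2) *\<^sub>R C = (q *\<^sub>R B' + r *\<^sub>R C') - B"
    unfolding 1(3) 2(3) by (simp add: algebra_simps)
  then have e1: "q * t + r * t2 = 1" "q * u + r * u2 = 0" using ind[of "q * t + r * t2 - 1" "q * u + r * u2"] 3(3)[symmetric] by simp_all
  have "(q2 * t + r2 * t2) *\<^sub>R B + (q2 * u + r2 * u2 - 1) *\<^sub>R C = (q2 *\<^sub>R B' + r2 *\<^sub>R C') - C"
    unfolding 1(3) 2(3) by (simp add: algebra_simps)
  then have e2: "q2 * t + r2 * t2 = 0" "q2 * u + r2 * u2 = 1" using ind[of "q2 * t + r2 * t2" "q2 * u + r2 * u2 - 1"] 4(3)[symmetric] by simp_all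
  have z: "q * u = 0" "r * u2 = 0" "q2 * t = 0" "r2 * t2 = 0"
    using e1(2) e2(1) 1(1,2) 2(1,2) 3(1,2) 4(1,2)
    by (simp_all add: add_nonneg_eq_0_iff)
  show ?thesis
  proof (cases "q = 0")
    case False
    then have "u = 0" using z by simp
    then have "r2 \<noteq> 0" "u2 \<noteq> 0" using e2 by auto
    then have "t2 = 0" using z by simp
    then have "t \<noteq> 0" using e1 by auto
    have "corner_angle v b' c' = corner_angle v b c"
    proof (rule corner_angle_scale)
      show "tangent_part v b' = t *\<^sub>R tangent_part v b" "tangent_part v c' = u2 *\<^sub>R tangent_part v c"
        using 1(3) 2(3) \<open>u = 0\<close> \<open>t2 = 0\<close> unfolding BC by simp_all
    qed (use 1 2 \<open>t \<noteq> 0\<close> \<open>u2 \<noteq> 0\<close> in linarith)+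
    then show ?thesis using bc(3) bc'(3) by simp
  next
    case True
    then have "r \<noteq> 0" "t2 \<noteq> 0" using e1 by auto
    then have "u2 = 0" using z by simp
    then have "q2 \<noteq> 0" "u \<noteq> 0" using e2 by auto
    then have "t = 0" using z by simp
    have "corner_angle v b' c' = corner_angle v c b"
    proof (rule corner_angle_scale)
      show "tangent_part v b' = u *\<^sub>R tangent_part v c" "tangent_part v c' = t2 *\<^sub>R tangent_part v b"
        using 1(3) 2(3) \<open>t = 0\<close> \<open>u2 = 0\<close> unfolding BC by simp_all
    qed (use 1 2 \<open>t2 \<noteq> 0\<close> \<open>u \<noteq> 0\<close> in linarith)+
    then show ?thesis using bc(3) bc'(3) corner_angle_commute[of v c b] by simp
  qed
qed

end

theory Submission
  imports Defs
begin

text \<open>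
  Record the triangle by the multiset \<open>M\<close> of the cosines of its sides. Half a turn around a vertex
  consists of \<open>n\<close> triangles whose angles add up to \<open>\<pi>\<close>. Each of them has two legs at the vertex and
  a base opposite to it; consecutive triangles share a leg, and triangles that differ by half a
  turn have equal angles and hence equal bases. If the bases are not all equal, then the legs
  repeat after half a turn as well, and counting each leg in both adjacent triangles gives
  \<open>2 legs + bases = n M\<close> as an identity of multisets. Since the angles of a triangle add up to more than
  \<open>\<pi>\<close>, some side occurs less often among the bases than in \<open>M\<close>. By parity this side does not occur
  as a base at all, the triangle is scalene, and the other two sides occur an even number of times
  as a base. In all cases an angle occurs at least twice in half a turn, if it occurs at all, so
  every angle of the triangle is at most \<open>\<pi> / 2\<close>. Two different angles \<open>\<alpha>\<close> and \<open>\<beta>\<close> at a vertex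
  satisfy \<open>2 \<alpha> + 2 \<beta> \<le> \<pi>\<close>, and the third angle would have to exceed \<open>\<pi> / 2\<close>.
\<close>

section \<open>Spherical trigonometry\<close>

definition gram_det :: "real \<Rightarrow> real \<Rightarrow> real \<Rightarrow> real" where
  "gram_det A B C = 1 - A\<^sup>2 - B\<^sup>2 - C\<^sup>2 + 2 * A * B * C"

text \<open>The arguments are the cosines of the side lengths of a spherical triangle.\<close>

definition spherical_sides :: "real \<Rightarrow> real \<Rightarrow> real \<Rightarrow> bool" where
  "spherical_sides A B C \<longleftrightarrow> \<bar>A\<bar> < 1 \<and> \<bar>B\<bar> < 1 \<and> \<bar>C\<bar> < 1 \<and> 0 < gram_det A B C"

text \<open>The spherical law of cosines: \<open>M\<close> consists of the cosines of the three sides, and \<open>y\<close> is the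
  cosine of the side opposite to the angle.\<close>

definition opposite_angle :: "real multiset \<Rightarrow> real \<Rightarrow> real" where
  "opposite_angle M y = arccos ((y - prod_mset (M - {#y#})) /
     (\<Prod>z\<in>#M - {#y#}. sqrt (1 - z\<^sup>2)))"

lemma gram_det_commute:
  "gram_det B A C = gram_det A B C" "gram_det A C B = gram_det A B C"
  by (simp_all add: gram_det_def algebra_simps)

lemma spherical_sides_commute:
  "spherical_sides B A C \<longleftrightarrow> spherical_sides A B C"
  "spherical_sides A C B \<longleftrightarrow> spherical_sides A B C"
  by (auto simp: spherical_sides_def gram_det_commute)

lemma
  assumes "spherical_sides A B C"
  shows cos_opposite_angle:
      "cos (opposite_angle {#A, B, C#} A) = (A - B * C) / (sqrt (1 - B\<^sup>2) * sqrt (1 - C\<^sup>2))"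
    and sin_opposite_angle:
      "sin (opposite_angle {#A, B, C#} A)
        = sqrt (gram_det A B C) / (sqrt (1 - B\<^sup>2) * sqrt (1 - C\<^sup>2))"
    and opposite_angle_pos: "0 < opposite_angle {#A, B, C#} A"
    and opposite_angle_lt_pi: "opposite_angle {#A, B, C#} A < pi"
proof -
  define q where "q = sqrt (1 - B\<^sup>2) * sqrt (1 - C\<^sup>2)"
  define t where "t = (A - B * C) / q"
  have angle: "opposite_angle {#A, B, C#} A = arccos t"
    by (simp add: opposite_angle_def t_def q_def)
  have BC: "B\<^sup>2 < 1" "C\<^sup>2 < 1" and gram: "0 < gram_det A B C"
    using assms by (simp_all add: spherical_sides_def abs_square_less_1)
  have q: "0 < q" and q2: "q\<^sup>2 = (1 - B\<^sup>2) * (1 - C\<^sup>2)"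
    using BC by (simp_all add: q_def power_mult_distrib)
  have "q\<^sup>2 - (A - B * C)\<^sup>2 = gram_det A B C"
    unfolding q2 gram_det_def by (simp add: power2_eq_square algebra_simps)
  then have t2: "1 - t\<^sup>2 = gram_det A B C / q\<^sup>2"
    using q by (simp add: t_def power_divide diff_divide_eq_iff)
  then have "t\<^sup>2 < 1" using gram q by (smt (verit) divide_pos_pos zero_less_power)
  then have t: "-1 < t" "t < 1" by (simp_all add: abs_square_less_1 abs_less_iff)
  show "cos (opposite_angle {#A, B, C#} A) = (A - B * C) / (sqrt (1 - B\<^sup>2) * sqrt (1 - C\<^sup>2))"
    using t by (simp add: angle t_def q_def)
  have "sin (arccos t) = sqrt (gram_det A B C) / q"
    using t q by (simp add: sin_arccos t2 real_sqrt_divide)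
  then show "sin (opposite_angle {#A, B, C#} A)
      = sqrt (gram_det A B C) / (sqrt (1 - B\<^sup>2) * sqrt (1 - C\<^sup>2))"
    unfolding angle q_def .
  show "0 < opposite_angle {#A, B, C#} A" "opposite_angle {#A, B, C#} A < pi"
    using arccos_lt_bounded[OF t] by (simp_all add: angle)
qed

lemma cos_sum_opposite_angles_neg:
  assumes ABC: "spherical_sides A B C"
  shows "cos (opposite_angle {#A, B, C#} A)
    + cos (opposite_angle {#A, B, C#} B + opposite_angle {#A, B, C#} C) < 0"
proof -
  define p q r D where "p = sqrt (1 - A\<^sup>2)" "q = sqrt (1 - B\<^sup>2)" "r = sqrt (1 - C\<^sup>2)"
    "D = gram_det A B C"
  note defs = this
  have BAC: "spherical_sides B A C" and CAB: "spherical_sides C A B"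
    using ABC spherical_sides_commute by blast+
  have "A < 1" "0 < D" and pqr: "0 < p" "0 < q" "0 < r"
    using ABC by (simp_all add: defs spherical_sides_def abs_square_less_1 abs_less_iff)
  have p2: "p * p = 1 - A\<^sup>2" and D2: "sqrt D * sqrt D = D"
    using pqr \<open>0 < D\<close> by (simp_all add: defs)
  have \<alpha>: "cos (opposite_angle {#A, B, C#} A) = (A - B * C) / (q * r)"
    using cos_opposite_angle[OF ABC] by (simp add: defs)
  have \<beta>: "cos (opposite_angle {#A, B, C#} B) = (B - A * C) / (p * r)"
      "sin (opposite_angle {#A, B, C#} B) = sqrt D / (p * r)"
    using BAC[THEN cos_opposite_angle] BAC[THEN sin_opposite_angle]
    by (simp_all add: defs add_mset_commute gram_det_commute)
  have \<gamma>: "cos (opposite_angle {#A, B, C#} C) = (C - A * B) / (p * q)"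
      "sin (opposite_angle {#A, B, C#} C) = sqrt D / (p * q)"
    using CAB[THEN cos_opposite_angle] CAB[THEN sin_opposite_angle]
    by (simp_all add: defs add_mset_commute gram_det_commute)
  have "cos (opposite_angle {#A, B, C#} B + opposite_angle {#A, B, C#} C)
      = ((B - A * C) * (C - A * B) - D) / ((p * p) * (q * r))"
    unfolding cos_add \<beta> \<gamma> times_divide_times_eq D2
      diff_divide_distrib[of "(B - A * C) * (C - A * B)" D] by (simp only: mult_ac)
  moreover have "(A - B * C) / (q * r) = ((A - B * C) * (p * p)) / ((p * p) * (q * r))"
    using pqr by simp
  ultimately have "cos (opposite_angle {#A, B, C#} A)
      + cos (opposite_angle {#A, B, C#} B + opposite_angle {#A, B, C#} C)
      = ((A - B * C) * (p * p) + ((B - A * C) * (C - A * B) - D)) / ((p * p) * (q * r))"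
    by (simp only: \<alpha> add_divide_distrib)
  also have "(A - B * C) * (p * p) + ((B - A * C) * (C - A * B) - D) = - ((1 - A) * D)"
    unfolding p2 by (simp add: defs gram_det_def power2_eq_square algebra_simps)
  also have "- ((1 - A) * D) / ((p * p) * (q * r)) < 0"
    using pqr \<open>A < 1\<close> \<open>0 < D\<close> by (intro divide_neg_pos) simp_all
  finally show ?thesis .
qed

lemma spherical_excess:
  assumes ABC: "spherical_sides A B C"
  shows "pi < (\<Sum>z\<in>#{#A, B, C#}. opposite_angle {#A, B, C#} z)"
proof -
  define \<alpha> \<beta> \<gamma> where "\<alpha> = opposite_angle {#A, B, C#} A" "\<beta> = opposite_angle {#A, B, C#} B"
    "\<gamma> = opposite_angle {#A, B, C#} C"
  note angles = this
  have "0 < \<alpha>" "\<alpha> < pi" "0 < \<beta>" "0 < \<gamma>"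
    using opposite_angle_pos[OF ABC] opposite_angle_lt_pi[OF ABC] opposite_angle_pos[of B A C]
      opposite_angle_pos[of C A B] ABC spherical_sides_commute
    by (auto simp: angles add_mset_commute)
  moreover have "cos \<alpha> < cos (pi - (\<beta> + \<gamma>))"
    using cos_sum_opposite_angles_neg[OF ABC] by (simp add: angles cos_diff)
  ultimately have "pi - (\<beta> + \<gamma>) < \<alpha>"
    using cos_monotone_0_pi_le[of \<alpha> "pi - (\<beta> + \<gamma>)"] by linarith
  then show ?thesis by (simp add: angles)
qed

text \<open>By the law of sines, equal angles lie opposite to sides of equal sine.\<close>

lemma opposite_angle_eq_imp_eq:
  assumes ABC: "spherical_sides A B C"
    and eq: "opposite_angle {#A, B, C#} A = opposite_angle {#A, B, C#} B"
  shows "A = B"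
proof -
  define p q r D where "p = sqrt (1 - A\<^sup>2)" "q = sqrt (1 - B\<^sup>2)" "r = sqrt (1 - C\<^sup>2)"
    "D = gram_det A B C"
  note defs = this
  have BAC: "spherical_sides B A C" and perm: "{#B, A, C#} = {#A, B, C#}"
    using ABC by (simp_all add: spherical_sides_commute add_mset_commute)
  have "-1 < C" "0 < D" and pqr: "0 < p" "0 < q" "0 < r"
    using ABC by (simp_all add: defs spherical_sides_def abs_square_less_1 abs_less_iff)
  have "sqrt D / (q * r) = sqrt D / (p * r)"
    using sin_opposite_angle[OF ABC] sin_opposite_angle[OF BAC] eq
    by (simp add: defs perm gram_det_commute)
  then have "p = q" using pqr \<open>0 < D\<close> by (simp add: frac_eq_eq)
  moreover have "(A - B * C) / (q * r) = (B - A * C) / (p * r)"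
    using cos_opposite_angle[OF ABC] cos_opposite_angle[OF BAC] eq by (simp add: defs perm)
  ultimately have "A - B * C = B - A * C" using pqr by simp
  then have "(A - B) * (1 + C) = 0" by (simp add: algebra_simps)
  then show ?thesis using \<open>-1 < C\<close> by simp
qed

lemma inj_on_opposite_angle:
  assumes ABC: "spherical_sides A B C"
  shows "inj_on (opposite_angle {#A, B, C#}) {A, B, C}"
proof -
  have perm: "{#A, C, B#} = {#A, B, C#}" "{#B, C, A#} = {#A, B, C#}"
    by (simp_all add: add_mset_commute)
  have "spherical_sides A C B" "spherical_sides B C A"
    using ABC spherical_sides_commute by blast+
  from ABC[THEN opposite_angle_eq_imp_eq] this[THEN opposite_angle_eq_imp_eq, unfolded perm]
  show ?thesis unfolding inj_on_def by (metis insertE singletonD)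
qed

section \<open>Angle patterns around a vertex\<close>

text \<open>The combinatorics of half a turn around a vertex: \<open>n\<close> triangles fit into it, \<open>leg i\<close> is the
  \<open>i\<close>-th side leaving the vertex, and \<open>base i\<close> is the side opposite to the vertex in the
  triangle between \<open>leg i\<close> and \<open>leg (Suc i)\<close>. Only the congruence classes of the sides matter.\<close>

locale half_turn_pattern =
  fixes M :: "'a multiset" and angle :: "'a \<Rightarrow> real" and n :: nat and leg base :: "nat \<Rightarrow> 'a"
  assumes angle_pos: "\<And>z. z \<in># M \<Longrightarrow> 0 < angle z"
    and angle_sum: "pi < (\<Sum>z\<in>#M. angle z)"
    and n_ge_2: "2 \<le> n"
    and sides: "\<And>i. {#leg i, leg (Suc i), base i#} = M"
    and base_periodic: "\<And>i. base (i + n) = base i"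
    and half_turn: "(\<Sum>i<n. angle (base i)) = pi"
begin

definition bases :: "'a multiset" where
  "bases = (\<Sum>i<n. {#base i#})"

definition legs :: "'a multiset" where
  "legs = (\<Sum>i<n. {#leg i#})"

lemma base_in_M: "base i \<in># M"
  unfolding sides[of i, symmetric] by simp

lemma base_in_bases: "base i \<in># bases"
proof -
  have "base (i mod n + k * n) = base (i mod n)" for k
    by (induction k) (use base_periodic[of "i mod n + l * n" for l] in \<open>simp_all add: add_ac\<close>)
  from this[of "i div n"] have "base i = base (i mod n)" by simp
  moreover have "i mod n < n" using n_ge_2 by simp
  ultimately show ?thesis by (auto simp: bases_def set_mset_sum)
qed

lemma bases_subset_M: "set_mset bases \<subseteq> set_mset M"
  using base_in_M by (auto simp: bases_def set_mset_sum)

lemma sum_angle_bases: "(\<Sum>z\<in>#bases. angle z) = pi"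
proof -
  have "(\<Sum>z\<in>#(\<Sum>i<m. {#base i#}). angle z) = (\<Sum>i<m. angle (base i))" for m
    by (induction m) simp_all
  then show ?thesis by (simp add: bases_def half_turn)
qed

lemma sum_angle_sub_bases:
  assumes "A \<subseteq># bases"
  shows "(\<Sum>z\<in>#A. angle z) \<le> pi"
proof -
  have "0 \<le> (\<Sum>z\<in>#B. angle z)" if "set_mset B \<subseteq> set_mset M" for B
    using that by (induction B) (auto intro!: add_nonneg_nonneg simp: angle_pos less_imp_le)
  moreover have "set_mset (bases - A) \<subseteq> set_mset M"
    using bases_subset_M by (auto dest: in_diffD)
  ultimately have "0 \<le> (\<Sum>z\<in>#bases - A. angle z)" by blast
  moreover have "(\<Sum>z\<in>#bases. angle z) = (\<Sum>z\<in>#A. angle z) + (\<Sum>z\<in>#bases - A. angle z)"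
    using assms by (simp flip: sum_mset.union image_mset_union)
  ultimately show ?thesis by (simp add: sum_angle_bases)
qed

text \<open>If two consecutive bases differ, then the leg between them is the third side of the triangle,
  and this leg determines all the others, one by one.\<close>

lemma leg_periodic:
  assumes "base j \<noteq> base k"
  shows "leg (i + n) = leg i"
proof -
  obtain l where l: "base l \<noteq> base (Suc l)"
  proof -
    have "base l = base 0" if "\<And>l. base l = base (Suc l)" for l
      by (induction l) (use that in auto)
    then show ?thesis using that assms by metis
  qed
  have third: "{#base m, base (Suc m), leg (Suc m)#} = M" if "base m \<noteq> base (Suc m)" for m
  proof -
    have "{#leg m, base m#} = {#leg (Suc (Suc m)), base (Suc m)#}"
      using sides[of m] sides[of "Suc m"] by (metis add_mset_commute add_mset_add_mset_same_iff)
    then have "leg m = base (Suc m)" using that by (auto simp: add_eq_conv_ex)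
    then show ?thesis using sides[of m] by (simp add: add_mset_commute)
  qed
  have "leg (Suc l + n) = leg (Suc l)"
    using third[of l] third[of "l + n"] l base_periodic[of l] base_periodic[of "Suc l"] by auto
  moreover have "leg (Suc i + n) = leg (Suc i) \<longleftrightarrow> leg (i + n) = leg i" for i
  proof -
    have "{#leg (i + n), leg (Suc i + n)#} = {#leg i, leg (Suc i)#}"
      using sides[of i] sides[of "i + n"] base_periodic[of i]
      by (metis add_Suc add_mset_commute add_mset_add_mset_same_iff)
    then show ?thesis by (auto simp: add_eq_conv_ex)
  qed
  then have "leg (i + n) = leg i \<longleftrightarrow> leg (0 + n) = leg 0" for i
    by (induction i) simp_all
  ultimately show ?thesis by blast
qed

text \<open>Double counting: over half a turn every leg belongs to the triangles on both of its sides.\<close>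

lemma double_count:
  assumes "base j \<noteq> base k"
  shows "legs + legs + bases = repeat_mset n M"
proof -
  have "(\<Sum>i<n. {#leg (Suc i)#}) + {#leg 0#} = (\<Sum>i<n. {#leg i#}) + {#leg n#}"
    using sum.lessThan_Suc[of "\<lambda>i. {#leg i#}" n] sum.lessThan_Suc_shift[of "\<lambda>i. {#leg i#}" n]
    by simp
  then have shift: "(\<Sum>i<n. {#leg (Suc i)#}) = legs"
    using leg_periodic[OF assms, of 0] by (simp add: legs_def)
  have triple: "M = {#leg i#} + {#leg (Suc i)#} + {#base i#}" for i
    using sides[of i] by (simp add: add_mset_commute)
  have "repeat_mset m M = (\<Sum>i<m. M)" for m
    by (induction m) simp_all
  also have "(\<Sum>i<n. M) = (\<Sum>i<n. {#leg i#} + {#leg (Suc i)#} + {#base i#})"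
    by (intro sum.cong refl triple)
  finally show ?thesis by (simp only: sum.distrib shift legs_def bases_def)
qed

text \<open>The angles at the vertex add up to less than those of a triangle, so some side occurs less
  often as a base than as a side of the triangle. By parity, it does not occur as a base at all.\<close>

lemma unused_base:
  assumes ne: "base j \<noteq> base k"
  obtains z where "M = {#base j, base k, z#}" "z \<noteq> base j" "z \<noteq> base k" "z \<notin># bases"
proof -
  have "\<not> M \<subseteq># bases" using sum_angle_sub_bases[of M] angle_sum by linarith
  then obtain z where z: "count bases z < count M z" by (auto simp: subseteq_mset_def not_le)
  obtain w where M: "M = {#base j, base k, w#}"
  proof -
    have "base k \<in># M - {#base j#}" using base_in_M ne by (simp add: in_diff_count not_in_iff)
    then have "base k \<in># M - {#base j#}" "base j \<in># M" using base_in_M by simp_all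
    then obtain K where K: "M = {#base j, base k#} + K" by (auto dest!: multi_member_split)
    then have "size K = Suc 0" using arg_cong[OF sides[of 0], of size] by simp
    then show ?thesis using that K size_1_singleton_mset by fastforce
  qed
  have "z \<noteq> base i" if "base i \<in> {base j, base k}" for i
  proof
    assume zi: "z = base i"
    have "0 < count bases z" unfolding zi using base_in_bases by simp
    moreover have "count M z \<le> 2" using ne by (auto simp: M)
    ultimately have count: "count bases z = 1" "count M z = 2" using z by linarith+
    have "2 * count legs z + count bases z = n * count M z"
      using arg_cong[OF double_count[OF ne], of "\<lambda>A. count A z"] by simp
    then have "2 * count legs z + 1 = n * 2" using count by simp
    then show False by presburger
  qed
  then have "z \<noteq> base j" "z \<noteq> base k" by auto
  moreover from this z have "z = w" "count bases z = 0" by (auto simp: M split: if_splits)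
  ultimately show thesis using that M by (simp add: not_in_iff)
qed

lemma two_le_count_bases: "2 \<le> count bases (base i)"
proof (cases "\<forall>j. base j = base i")
  case True
  then have "bases = (\<Sum>j<n. {#base i#})"
    unfolding bases_def by (intro sum.cong refl arg_cong[of _ _ "\<lambda>z. {#z#}"]) blast
  then show ?thesis using n_ge_2 by (simp add: count_sum)
next
  case False
  then obtain j where ne: "base j \<noteq> base i" by blast
  obtain z where M: "M = {#base j, base i, z#}" and z: "z \<noteq> base j" "z \<noteq> base i" "z \<notin># bases"
    by (rule unused_base[OF ne])
  have parity: "2 * count legs w + count bases w = n * count M w" for w
    using arg_cong[OF double_count[OF ne], of "\<lambda>A. count A w"] by simp
  have "2 * count legs z = n" using parity[of z] M z by (simp add: not_in_iff)
  moreover have "2 * count legs (base i) + count bases (base i) = n"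
    using parity[of "base i"] M z ne by simp
  ultimately have "even (count bases (base i))" by (metis dvd_add_right_iff dvd_triv_left)
  moreover have "0 < count bases (base i)" using base_in_bases by simp
  ultimately show ?thesis by (rule dvd_imp_le)
qed

lemma angle_base_le: "angle (base i) \<le> pi / 2"
proof -
  have "{#base i, base i#} \<subseteq># bases"
    using two_le_count_bases[of i] by (simp add: subseteq_mset_def)
  from sum_angle_sub_bases[OF this] show ?thesis by simp
qed

lemma base_constant:
  assumes le: "\<And>z. z \<in># M \<Longrightarrow> angle z \<le> pi / 2"
  shows "base j = base k"
proof (rule ccontr)
  assume ne: "base j \<noteq> base k"
  obtain z where M: "M = {#base j, base k, z#}" by (rule unused_base[OF ne])
  have "{#base j, base j, base k, base k#} \<subseteq># bases"
    using two_le_count_bases[of j] two_le_count_bases[of k] ne by (auto simp: subseteq_mset_def)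
  from sum_angle_sub_bases[OF this] have "2 * angle (base j) + 2 * angle (base k) \<le> pi" by simp
  moreover have "angle z \<le> pi / 2" using le by (simp add: M)
  ultimately show False using angle_sum by (simp add: M)
qed

end

section \<open>Periodic sets of real numbers\<close>

definition periodic_extension :: "real list \<Rightarrow> real \<Rightarrow> nat \<Rightarrow> real" where
  "periodic_extension xs p i = xs ! (i mod length xs) + real (i div length xs) * p"

lemma periodic_extension_add_length:
  "xs \<noteq> [] \<Longrightarrow> periodic_extension xs p (i + length xs) = periodic_extension xs p i + p"
  by (simp add: periodic_extension_def algebra_simps)

lemma strict_mono_periodic_extension:
  assumes "xs \<noteq> []" "sorted_wrt (<) xs" "set xs \<subseteq> {s..<s + p}"
  shows "strict_mono (periodic_extension xs p)"
  unfolding strict_mono_Suc_iff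
proof
  fix i
  have less: "i mod length xs < length xs" for i using assms(1) by simp
  show "periodic_extension xs p i < periodic_extension xs p (Suc i)"
  proof (cases "Suc (i mod length xs) = length xs")
    case True
    then have "periodic_extension xs p (Suc i) - periodic_extension xs p i
        = xs ! (Suc i mod length xs) + p - xs ! (i mod length xs)"
      by (simp add: periodic_extension_def div_Suc mod_Suc algebra_simps)
    moreover have "s \<le> xs ! (Suc i mod length xs)" "xs ! (i mod length xs) < s + p"
      using less nth_mem assms(3) by (force simp: subset_iff)+
    ultimately show ?thesis by simp
  next
    case False
    then have "periodic_extension xs p (Suc i) - periodic_extension xs p i
        = xs ! Suc (i mod length xs) - xs ! (i mod length xs)"
      by (simp add: periodic_extension_def div_Suc mod_Suc)
    moreover have "xs ! (i mod length xs) < xs ! Suc (i mod length xs)"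
      using False less[of i] by (intro sorted_wrt_nth_less[OF assms(2)]) auto
    ultimately show ?thesis by simp
  qed
qed

lemma periodic_set_shift:
  fixes D :: "real set"
  assumes "\<And>t. t + p \<in> D \<longleftrightarrow> t \<in> D"
  shows "t + real k * p \<in> D \<longleftrightarrow> t \<in> D"
proof (induction k)
  case (Suc k)
  then show ?case using assms[of "t + real k * p"] by (simp add: algebra_simps)
qed simp

lemma range_periodic_extension:
  assumes "0 < p" and periodic: "\<And>t. t + p \<in> D \<longleftrightarrow> t \<in> D"
    and xs: "xs \<noteq> []" "set xs = D \<inter> {s..<s + p}"
  shows "range (periodic_extension xs p) = D \<inter> {s..}"
proof (intro equalityI subsetI)
  fix t assume "t \<in> range (periodic_extension xs p)"
  then obtain i where t: "t = xs ! (i mod length xs) + real (i div length xs) * p"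
    by (auto simp: periodic_extension_def)
  have "xs ! (i mod length xs) \<in> D \<inter> {s..<s + p}" using xs by (auto simp flip: xs(2))
  then show "t \<in> D \<inter> {s..}"
    using \<open>0 < p\<close> periodic_set_shift[OF periodic] by (auto simp: t intro: add_increasing2)
next
  fix t assume t: "t \<in> D \<inter> {s..}"
  define k where "k = nat \<lfloor>(t - s) / p\<rfloor>"
  have "real k \<le> (t - s) / p" "(t - s) / p < real k + 1"
    using t \<open>0 < p\<close> by (simp_all add: k_def)
  then have "s \<le> t - real k * p" "t - real k * p < s + p"
    using \<open>0 < p\<close> by (simp_all add: field_simps)
  moreover have "t - real k * p \<in> D"
    using t periodic_set_shift[OF periodic, of "t - real k * p" k] by simp
  ultimately have "t - real k * p \<in> set xs" by (simp add: xs(2))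
  then obtain j where "j < length xs" "xs ! j = t - real k * p" by (auto simp: in_set_conv_nth)
  then have "periodic_extension xs p (j + k * length xs) = t"
    using xs(1) by (simp add: periodic_extension_def)
  then show "t \<in> range (periodic_extension xs p)" by blast
qed

lemma periodic_set_enumeration:
  fixes D :: "real set"
  assumes "0 < p" and periodic: "\<And>t. t + p \<in> D \<longleftrightarrow> t \<in> D"
    and "s \<in> D" and fin: "finite (D \<inter> {s..<s + p})"
  obtains f :: "nat \<Rightarrow> real" and n where
    "0 < n" "strict_mono f" "range f = D \<inter> {s..}" "\<And>i. f (i + n) = f i + p"
proof -
  define xs where "xs = sorted_list_of_set (D \<inter> {s..<s + p})"
  have xs: "sorted_wrt (<) xs" "set xs = D \<inter> {s..<s + p}" using fin by (simp_all add: xs_def)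
  then have "xs \<noteq> []" using \<open>0 < p\<close> \<open>s \<in> D\<close> by auto
  then show ?thesis
    using that[of "length xs" "periodic_extension xs p"] xs periodic_extension_add_length
      strict_mono_periodic_extension[of xs s p] range_periodic_extension[OF \<open>0 < p\<close> periodic]
    by auto
qed

lemma strict_mono_unbounded_bracket:
  fixes f :: "nat \<Rightarrow> real"
  assumes "f 0 \<le> t" "t < f k"
  obtains i where "f i \<le> t" "t < f (Suc i)"
proof -
  define m where "m = (LEAST m. t < f m)"
  have m: "t < f m" "\<And>i. i < m \<Longrightarrow> f i \<le> t"
    using LeastI[of "\<lambda>m. t < f m", OF \<open>t < f k\<close>] not_less_Least
    by (auto simp: m_def not_less[symmetric])
  then obtain i where "m = Suc i" using \<open>f 0 \<le> t\<close> by (cases m) auto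
  then show ?thesis using that m by blast
qed

section \<open>Polar coordinates in a plane\<close>

lemma angle_le_if_same_side:
  fixes s :: real
  assumes m: "s < m" "m < s'" "s' \<le> s + pi" and t: "s \<le> t" "t < s + 2 * pi"
    and same_side: "0 \<le> sin (m - s) * sin (t - s)" "0 \<le> sin (m - s') * sin (t - s')"
  shows "t \<le> s'"
proof -
  have "0 < sin (m - s)" "sin (m - s') < 0"
    using m sin_gt_zero[of "m - s"] sin_gt_zero[of "s' - m"] sin_minus[of "s' - m"] by simp_all
  then have sin: "0 \<le> sin (t - s)" "sin (t - s') \<le> 0"
    using same_side by (simp_all add: zero_le_mult_iff)
  have "t \<le> s + pi"
  proof (rule ccontr)
    assume "\<not> t \<le> s + pi"
    then have "sin (t - s) < 0" using t by (intro sin_lt_zero) auto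
    then show False using sin(1) by simp
  qed
  show ?thesis
  proof (rule ccontr)
    assume "\<not> t \<le> s'"
    then have "0 < sin (t - s')" using \<open>t \<le> s + pi\<close> m by (intro sin_gt_zero) auto
    then show False using sin(2) by simp
  qed
qed

locale orthonormal_pair =
  fixes e1 e2 :: "'a::real_inner"
  assumes orthonormal: "norm e1 = 1" "norm e2 = 1" "e1 \<bullet> e2 = 0"
begin

definition dir :: "real \<Rightarrow> 'a" where
  "dir t = cos t *\<^sub>R e1 + sin t *\<^sub>R e2"

lemma dir_plus_pi: "dir (t + pi) = - dir t"
  by (simp add: dir_def)

lemma dir_add: "dir (s + t) = cos t *\<^sub>R dir s + sin t *\<^sub>R dir (s + pi / 2)"
  by (simp add: dir_def cos_add sin_add algebra_simps)

lemma inner_dir: "dir s \<bullet> dir t = cos (t - s)"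
  using orthonormal
  by (simp add: dir_def inner_add_left inner_add_right inner_commute cos_diff dot_square_norm
      mult.commute)

lemma norm_dir: "norm (dir t) = 1"
  by (simp add: norm_eq_sqrt_inner inner_dir)

lemma polar_coordinates:
  assumes "w \<in> span {e1, e2}" "w \<noteq> 0"
  obtains r t where "0 < r" "w = r *\<^sub>R dir t" "s \<le> t" "t < s + 2 * pi"
proof -
  obtain x y where w: "w = x *\<^sub>R e1 + y *\<^sub>R e2"
    using assms(1) by (auto simp: span_insert span_singleton algebra_simps diff_eq_eq)
  define r where "r = sqrt (x\<^sup>2 + y\<^sup>2)"
  have "x \<noteq> 0 \<or> y \<noteq> 0" using w assms(2) by auto
  then have r: "0 < r" "r\<^sup>2 = x\<^sup>2 + y\<^sup>2" by (simp_all add: r_def sum_power2_gt_zero_iff)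
  then have "(x / r)\<^sup>2 + (y / r)\<^sup>2 = 1"
    using \<open>x \<noteq> 0 \<or> y \<noteq> 0\<close> by (simp add: power_divide flip: add_divide_distrib)
  then obtain u where u: "x / r = cos u" "y / r = sin u" using sincos_total_2pi by metis
  define k where "k = \<lceil>(s - u) / (2 * pi)\<rceil>"
  define t where "t = u + of_int k * (2 * pi)"
  have "(s - u) / (2 * pi) \<le> of_int k" "of_int k - 1 < (s - u) / (2 * pi)"
    unfolding k_def by linarith+
  then have "s - u \<le> of_int k * (2 * pi)" "(of_int k - 1) * (2 * pi) < s - u"
    using pos_divide_le_eq[of "2 * pi"] pos_less_divide_eq[of "2 * pi"] by simp_all
  then have "s \<le> t" "t < s + 2 * pi" by (simp_all add: t_def algebra_simps)
  moreover have "dir t = dir u"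
    using sin.plus_of_int[of u k] cos.plus_of_int[of u k] by (simp add: dir_def t_def)
  then have "w = r *\<^sub>R dir t"
    using r(1) by (simp add: w dir_def scaleR_add_right flip: u)
  ultimately show ?thesis using that r(1) by blast
qed

lemma inner_dir_eq_sin:
  assumes p: "p \<in> span {e1, e2}" "p \<noteq> 0" and s: "p \<bullet> dir s = 0"
  obtains R where "R \<noteq> 0" "\<And>t. p \<bullet> dir t = R * sin (t - s)"
proof
  define R where "R = p \<bullet> dir (s + pi / 2)"
  show dir: "p \<bullet> dir t = R * sin (t - s)" for t
    using dir_add[of s "t - s"] s by (simp add: R_def inner_add_right)
  show "R \<noteq> 0"
  proof
    assume "R = 0"
    obtain r t where "0 < r" "p = r *\<^sub>R dir t" by (rule polar_coordinates[OF p])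
    then show False using dir[of t] \<open>R = 0\<close> by (simp add: inner_dir)
  qed
qed

end

section \<open>Spherical triangles\<close>

unbundle cross3_syntax

lemma triangle_corners_norm:
  assumes "triangle_corners a b c"
  shows "norm a = 1" "norm b = 1" "norm c = 1"
  using assms by (auto simp: triangle_corners_def)

lemma triangle_corners_commute:
  "triangle_corners b a c \<longleftrightarrow> triangle_corners a b c"
  "triangle_corners a c b \<longleftrightarrow> triangle_corners a b c"
  by (simp_all add: triangle_corners_def insert_commute)

lemma triangle_corners_independent:
  assumes "triangle_corners a b c" "s *\<^sub>R a + t *\<^sub>R b + u *\<^sub>R c = 0"
  shows "s = 0" "t = 0" "u = 0"
  using assms dim3_indep[of a b c s t u] by (simp_all add: triangle_corners_def)

lemma triangle_corners_coords:
  assumes "triangle_corners a b c"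
  obtains s t u where "x = s *\<^sub>R a + t *\<^sub>R b + u *\<^sub>R c"
proof -
  have "span {a, b, c} = UNIV"
    using assms dim_eq_full[of "{a, b, c}"] by (simp add: triangle_corners_def)
  then have "x \<in> span {a, b, c}" by simp
  then obtain s t u where "x - s *\<^sub>R a - t *\<^sub>R b = u *\<^sub>R c"
    by (auto simp: span_insert span_singleton)
  then have "x = s *\<^sub>R a + t *\<^sub>R b + u *\<^sub>R c" by (simp add: diff_eq_eq add_ac)
  then show ?thesis using that by blast
qed

lemma triangle_corners_orthogonal_imp_0:
  assumes "triangle_corners a b c" "p \<bullet> a = 0" "p \<bullet> b = 0" "p \<bullet> c = 0"
  shows "p = 0"
proof -
  obtain s t u where "p = s *\<^sub>R a + t *\<^sub>R b + u *\<^sub>R c"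
    by (rule triangle_corners_coords[OF assms(1)])
  then have "p \<bullet> p = p \<bullet> (s *\<^sub>R a + t *\<^sub>R b + u *\<^sub>R c)" by (rule arg_cong)
  also have "\<dots> = 0" using assms(2-4) by (simp add: inner_add_right)
  finally show ?thesis by simp
qed

lemma triangle_corners_distinct:
  assumes "triangle_corners a b c"
  shows "a \<noteq> b" "a \<noteq> c" "b \<noteq> c"
  using triangle_corners_independent(1)[OF assms, of 1 "-1" 0]
    triangle_corners_independent(1)[OF assms, of 1 0 "-1"]
    triangle_corners_independent(2)[OF assms, of 0 1 "-1"] by auto

lemma triangle_region_commute:
  "triangle_region b a c = triangle_region a b c"
  "triangle_region a c b = triangle_region a b c"
proof -
  have subset: "triangle_region a b c \<subseteq> triangle_region b a c"
    "triangle_region a b c \<subseteq> triangle_region a c b" for a b c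
  proof -
    have "s *\<^sub>R a + t *\<^sub>R b + u *\<^sub>R c = t *\<^sub>R b + s *\<^sub>R a + u *\<^sub>R c"
      "s *\<^sub>R a + t *\<^sub>R b + u *\<^sub>R c = s *\<^sub>R a + u *\<^sub>R c + t *\<^sub>R b" for s t u
      by (simp_all add: ac_simps)
    then show "triangle_region a b c \<subseteq> triangle_region b a c"
      "triangle_region a b c \<subseteq> triangle_region a c b"
      unfolding triangle_region_def by blast+
  qed
  show "triangle_region b a c = triangle_region a b c"
    "triangle_region a c b = triangle_region a b c"
    by (intro equalityI subset)+
qed

lemma corners_in_triangle_region:
  assumes "triangle_corners a b c"
  shows "{a, b, c} \<subseteq> triangle_region a b c"
proof -
  have "a \<in> triangle_region a b c" if "norm a = 1" for a b c
  proof -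
    have "a = 1 *\<^sub>R a + 0 *\<^sub>R b + 0 *\<^sub>R c" by simp
    then have "\<exists>s t u. s \<ge> 0 \<and> t \<ge> 0 \<and> u \<ge> 0 \<and> a = s *\<^sub>R a + t *\<^sub>R b + u *\<^sub>R c"
      by (metis order_refl zero_le_one)
    then show ?thesis using that by (simp add: triangle_region_def)
  qed
  from this[of a b c] this[of b a c] this[of c a b]
  show ?thesis
    using triangle_corners_norm[OF assms] triangle_region_commute(1)[of b a c]
      triangle_region_commute(1)[of c a b] triangle_region_commute(2)[of a c b] by simp
qed

definition has_corners :: "(real ^ 3) set \<Rightarrow> real ^ 3 \<Rightarrow> real ^ 3 \<Rightarrow> real ^ 3 \<Rightarrow> bool" where
  "has_corners T a b c \<longleftrightarrow> triangle_corners a b c \<and> T = triangle_region a b c"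

lemma has_corners_commute:
  "has_corners T b a c \<longleftrightarrow> has_corners T a b c"
  "has_corners T a c b \<longleftrightarrow> has_corners T a b c"
  by (simp_all add: has_corners_def triangle_region_commute triangle_corners_commute)

lemma has_cornersD:
  assumes "has_corners T a b c"
  shows "triangle_corners a b c" "T = triangle_region a b c" "{a, b, c} \<subseteq> T"
  using assms corners_in_triangle_region[of a b c] by (simp_all add: has_corners_def)

lemma has_angle_at_iff: "has_angle_at T v \<alpha> \<longleftrightarrow> (\<exists>b c. has_corners T v b c \<and> \<alpha> = corner_angle v b c)"
  by (auto simp: has_angle_at_def has_corners_def)

definition side_cosines :: "real ^ 3 \<Rightarrow> real ^ 3 \<Rightarrow> real ^ 3 \<Rightarrow> real multiset" where
  "side_cosines a b c = {#b \<bullet> c, a \<bullet> c, a \<bullet> b#}"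

lemma side_cosines_cong:
  assumes "{a, b, c} = {p, q, r}" "triangle_corners a b c" "triangle_corners p q r"
  shows "side_cosines a b c = side_cosines p q r"
proof -
  have "a \<noteq> b" "a \<noteq> c" "b \<noteq> c" "p \<noteq> q" "p \<noteq> r" "q \<noteq> r"
    using triangle_corners_distinct[OF assms(2)] triangle_corners_distinct[OF assms(3)] by blast+
  moreover have "p \<in> {a, b, c}" "{q, r} = {a, b, c} - {p}" using assms(1) calculation by auto
  ultimately consider "p = a" "{q, r} = {b, c}" | "p = b" "{q, r} = {a, c}"
    | "p = c" "{q, r} = {a, b}"
    by auto
  then show ?thesis
    by cases (auto simp: doubleton_eq_iff side_cosines_def inner_commute add_mset_commute)
qed

definition has_side_cosines :: "(real ^ 3) set \<Rightarrow> real multiset \<Rightarrow> bool" where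
  "has_side_cosines T M \<longleftrightarrow>
     (\<exists>a b c. has_corners T a b c \<and> side_cosines a b c = M)"

lemma orthogonal_transformation_has_corners:
  assumes h: "orthogonal_transformation h" and T: "has_corners T a b c"
  shows "has_corners (h ` T) (h a) (h b) (h c)"
proof -
  note tri = has_cornersD(1,2)[OF T]
  have lin: "linear h" and norm: "\<And>x. norm (h x) = norm x"
    using h by (simp_all add: orthogonal_transformation_linear orthogonal_transformation_norm)
  have coords: "h (s *\<^sub>R a + t *\<^sub>R b + u *\<^sub>R c) = s *\<^sub>R h a + t *\<^sub>R h b + u *\<^sub>R h c"
    for s t u
    by (simp add: linear_add[OF lin] linear_scale[OF lin])
  have "dim (h ` {a, b, c}) = dim {a, b, c}"
    using lin orthogonal_transformation_inj[OF h]
    by (rule dim_image_eq[OF _ inj_on_subset]) simp_all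
  then have "triangle_corners (h a) (h b) (h c)"
    using tri(1) norm by (simp add: triangle_corners_def)
  moreover have "h ` T = triangle_region (h a) (h b) (h c)"
  proof (intro equalityI subsetI)
    fix y assume "y \<in> triangle_region (h a) (h b) (h c)"
    then obtain s t u where "s \<ge> 0" "t \<ge> 0" "u \<ge> 0" "norm y = 1"
        and y: "y = h (s *\<^sub>R a + t *\<^sub>R b + u *\<^sub>R c)"
      unfolding triangle_region_def coords by auto
    then have "s *\<^sub>R a + t *\<^sub>R b + u *\<^sub>R c \<in> T"
      unfolding tri(2) triangle_region_def using norm[of "s *\<^sub>R a + t *\<^sub>R b + u *\<^sub>R c"] by auto
    then show "y \<in> h ` T" using y by blast
  qed (use coords norm in \<open>fastforce simp: tri(2) triangle_region_def\<close>)
  ultimately show ?thesis by (simp add: has_corners_def)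
qed

lemma sphere_isometry_in_sphere:
  assumes "sphere_isometry f" "x \<in> sphere 0 1"
  shows "f x \<in> sphere 0 1"
  using assms bij_betw_apply unfolding sphere_isometry_def by metis

lemma sphere_isometry_inner:
  assumes f: "sphere_isometry f" and xy: "x \<in> sphere 0 1" "y \<in> sphere 0 1"
  shows "f x \<bullet> f y = x \<bullet> y"
proof -
  have "f x \<in> sphere 0 1" "f y \<in> sphere 0 1"
    using sphere_isometry_in_sphere[OF f] xy by blast+
  then have "\<bar>f x \<bullet> f y\<bar> \<le> 1" "\<bar>x \<bullet> y\<bar> \<le> 1"
    using xy Cauchy_Schwarz_ineq2[of "f x" "f y"] Cauchy_Schwarz_ineq2[of x y] by simp_all
  moreover have "arccos (f x \<bullet> f y) = arccos (x \<bullet> y)"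
    using f xy by (simp add: sphere_isometry_def sphere_dist_def)
  ultimately show ?thesis by (simp add: arccos_eq_iff)
qed

lemma sphere_isometry_extends:
  assumes f: "sphere_isometry f"
  obtains h where "orthogonal_transformation h" "\<And>x. x \<in> sphere 0 1 \<Longrightarrow> h x = f x"
proof -
  note sphere = sphere_isometry_in_sphere[OF f]
  have "dist (f x) (f y) = dist x y" if xy: "x \<in> sphere 0 1" "y \<in> sphere 0 1" for x y
    using xy[THEN sphere] xy sphere_isometry_inner[OF f xy]
    by (simp add: dist_norm norm_eq_sqrt_inner inner_diff_left inner_diff_right inner_commute)
  then show ?thesis using isometry_sphere_extend[of f] sphere that by auto
qed

lemma sphere_congruent_has_side_cosines:
  assumes "sphere_congruent S T" "has_side_cosines S M"
  shows "has_side_cosines T M"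
proof -
  obtain a b c where S: "has_corners S a b c" and M: "side_cosines a b c = M"
    using assms(2) unfolding has_side_cosines_def by blast
  obtain f where f: "sphere_isometry f" "f ` S = T"
    using assms(1) unfolding sphere_congruent_def by blast
  obtain h where h: "orthogonal_transformation h" "\<And>x. x \<in> sphere 0 1 \<Longrightarrow> h x = f x"
    using sphere_isometry_extends[OF f(1)] by blast
  have "h ` S = T"
    unfolding f(2)[symmetric]
    by (rule image_cong) (auto simp: h(2) has_cornersD(2)[OF S] triangle_region_def)
  then have "has_corners T (h a) (h b) (h c)"
    using orthogonal_transformation_has_corners[OF h(1) S] by simp
  moreover have "side_cosines (h a) (h b) (h c) = M"
    using h(1) by (simp add: side_cosines_def orthogonal_transformation_def flip: M)
  ultimately show ?thesis unfolding has_side_cosines_def by blast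
qed

lemma gram_det_eq_triple_product:
  assumes "norm a = 1" "norm b = 1" "norm c = 1"
  shows "gram_det (b \<bullet> c) (a \<bullet> c) (a \<bullet> b) = ((a \<times> b) \<bullet> c)\<^sup>2"
proof -
  have "c \<times> (a \<times> b) = (b \<bullet> c) *\<^sub>R a - (a \<bullet> c) *\<^sub>R b"
    by (simp add: Lagrange inner_commute)
  then have "(norm (c \<times> (a \<times> b)))\<^sup>2
      = (b \<bullet> c)\<^sup>2 + (a \<bullet> c)\<^sup>2 - 2 * (b \<bullet> c) * (a \<bullet> c) * (a \<bullet> b)"
    using assms dot_norm_neg[of "(b \<bullet> c) *\<^sub>R a" "(a \<bullet> c) *\<^sub>R b"]
    by (simp add: power_mult_distrib) argo
  moreover have "(norm (c \<times> (a \<times> b)))\<^sup>2 + (c \<bullet> (a \<times> b))\<^sup>2 = (norm (a \<times> b))\<^sup>2"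
    using norm_cross_dot[of c "a \<times> b"] assms by simp
  moreover have "(norm (a \<times> b))\<^sup>2 + (a \<bullet> b)\<^sup>2 = 1"
    using norm_cross_dot[of a b] assms by simp
  ultimately show ?thesis unfolding gram_det_def inner_commute[of "a \<times> b" c] by linarith
qed

lemma triangle_corners_triple_product:
  assumes tri: "triangle_corners a b c"
  shows "(a \<times> b) \<bullet> c \<noteq> 0"
proof
  assume "(a \<times> b) \<bullet> c = 0"
  then have "a \<times> b = 0"
    by (intro triangle_corners_orthogonal_imp_0[OF tri]) (simp_all add: dot_cross_self)
  then have "(b \<bullet> b) *\<^sub>R a + (- (b \<bullet> a)) *\<^sub>R b + 0 *\<^sub>R c = 0"
    using Lagrange[of b a b] by (simp add: algebra_simps)
  from triangle_corners_independent(1)[OF tri this] show False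
    using triangle_corners_norm[OF tri] by auto
qed

lemma spherical_sides_triangle:
  assumes tri: "triangle_corners a b c"
  shows "spherical_sides (b \<bullet> c) (a \<bullet> c) (a \<bullet> b)"
proof -
  have side: "\<bar>a \<bullet> b\<bar> < 1" if tri: "triangle_corners a b c" for a b c
  proof -
    have "a \<times> b \<noteq> 0" using triangle_corners_triple_product[OF tri] by auto
    then have "0 < (norm (a \<times> b))\<^sup>2" by simp
    moreover have "(norm (a \<times> b))\<^sup>2 + (a \<bullet> b)\<^sup>2 = 1"
      using norm_cross_dot[of a b] triangle_corners_norm[OF tri] by simp
    ultimately show ?thesis by (simp only: flip: abs_square_less_1)
  qed
  have "0 < gram_det (b \<bullet> c) (a \<bullet> c) (a \<bullet> b)"
    using triangle_corners_triple_product[OF tri] triangle_corners_norm[OF tri]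
    by (simp add: gram_det_eq_triple_product)
  then show ?thesis
    using side[of a b c] side[of a c b] side[of b c a] tri triangle_corners_commute
    unfolding spherical_sides_def by blast
qed

lemma corner_angle_eq_opposite_angle:
  assumes "triangle_corners v b c"
  shows "corner_angle v b c = opposite_angle (side_cosines v b c) (b \<bullet> c)"
proof -
  have unit: "v \<bullet> v = 1" "b \<bullet> b = 1" "c \<bullet> c = 1"
    using triangle_corners_norm[OF assms] by (simp_all add: dot_square_norm)
  then have "norm (tangent_part v x) = sqrt (1 - (v \<bullet> x)\<^sup>2)" if "x \<bullet> x = 1" for x
    using that by (simp add: norm_eq_sqrt_inner tangent_part_def inner_diff_left inner_diff_right
        inner_commute power2_eq_square)
  moreover have "tangent_part v b \<bullet> tangent_part v c = b \<bullet> c - (v \<bullet> b) * (v \<bullet> c)"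
    using unit by (simp add: tangent_part_def inner_diff_left inner_diff_right inner_commute)
  ultimately show ?thesis
    using unit by (simp add: corner_angle_def opposite_angle_def side_cosines_def mult.commute)
qed

lemma opposite_angle_side_cosines:
  assumes "triangle_corners a b c" and M: "M = side_cosines a b c"
  shows "pi < (\<Sum>z\<in>#M. opposite_angle M z)"
    and "inj_on (opposite_angle M) (set_mset M)"
    and "z \<in># M \<Longrightarrow> 0 < opposite_angle M z"
proof -
  define A B C where "A = b \<bullet> c" "B = a \<bullet> c" "C = a \<bullet> b"
  note defs = this
  have ABC: "spherical_sides A B C" and BAC: "spherical_sides B A C"
    and CAB: "spherical_sides C A B"
    using spherical_sides_triangle[OF assms(1)] spherical_sides_commute unfolding defs by blast+
  have perm: "M = {#A, B, C#}" "M = {#B, A, C#}" "M = {#C, A, B#}"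
    by (simp_all add: M side_cosines_def defs add_mset_commute)
  show "pi < (\<Sum>z\<in>#M. opposite_angle M z)" unfolding perm(1) by (rule spherical_excess[OF ABC])
  show "inj_on (opposite_angle M) (set_mset M)"
    using inj_on_opposite_angle[OF ABC] by (simp add: perm(1))
  show "0 < opposite_angle M z" if "z \<in># M"
    using that ABC[THEN opposite_angle_pos, folded perm(1)]
      BAC[THEN opposite_angle_pos, folded perm(2)] CAB[THEN opposite_angle_pos, folded perm(3)]
    by (auto simp: perm(1))
qed

section \<open>Chambers of a central arrangement\<close>

text \<open>The arrangement consists of the hyperplanes orthogonal to the vectors in \<open>P\<close>.\<close>

locale central_arrangement =
  fixes P :: "'a::euclidean_space set"
  assumes finite_normals: "finite P" and normals_nonempty: "P \<noteq> {}"
begin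

definition generic :: "'a \<Rightarrow> bool" where
  "generic x \<longleftrightarrow> (\<forall>p\<in>P. p \<bullet> x \<noteq> 0)"

definition open_cone :: "'a \<Rightarrow> 'a set" where
  "open_cone x = {y. \<forall>p\<in>P. 0 < (p \<bullet> x) * (p \<bullet> y)}"

definition closed_cone :: "'a \<Rightarrow> 'a set" where
  "closed_cone x = {y. \<forall>p\<in>P. 0 \<le> (p \<bullet> x) * (p \<bullet> y)}"

definition chamber :: "'a \<Rightarrow> 'a set" where
  "chamber x = closed_cone x \<inter> sphere 0 1"

definition chambers :: "'a set set" where
  "chambers = chamber ` {x. generic x}"

text \<open>For great circles, the vertices are the points that lie on at least two of them.\<close>

definition vertex :: "'a \<Rightarrow> bool" where
  "vertex v \<longleftrightarrow> norm v = 1 \<and> (\<forall>x. (\<forall>p\<in>P. p \<bullet> v = 0 \<longrightarrow> p \<bullet> x = 0) \<longrightarrow> x \<in> span {v})"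

lemma chambers_cases:
  assumes "T \<in> chambers"
  obtains x where "generic x" "T = chamber x"
  using assms by (auto simp: chambers_def)

lemma generic_nonzero: "generic x \<Longrightarrow> x \<noteq> 0"
  using normals_nonempty by (auto simp: generic_def)

lemma generic_in_open_cone: "generic x \<Longrightarrow> x \<in> open_cone x"
  by (simp add: generic_def open_cone_def flip: power2_eq_square)

lemma zero_notin_open_cone: "0 \<notin> open_cone x"
  using normals_nonempty by (auto simp: open_cone_def)

lemma open_cone_subset_closed_cone: "open_cone x \<subseteq> closed_cone x"
  by (auto simp: open_cone_def closed_cone_def less_imp_le)

lemma open_cone_scaleR: "0 < k \<Longrightarrow> k *\<^sub>R y \<in> open_cone x \<longleftrightarrow> y \<in> open_cone x"
  by (simp add: open_cone_def zero_less_mult_iff mult_less_0_iff)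

lemma closed_cone_add: "y \<in> closed_cone x \<Longrightarrow> z \<in> closed_cone x \<Longrightarrow> y + z \<in> closed_cone x"
  by (simp add: closed_cone_def inner_add_right distrib_left)

lemma closed_cone_scaleR: "0 \<le> k \<Longrightarrow> y \<in> closed_cone x \<Longrightarrow> k *\<^sub>R y \<in> closed_cone x"
  by (auto simp: closed_cone_def zero_le_mult_iff mult_le_0_iff)

lemma closed_cone_add_open_cone: "y \<in> closed_cone x \<Longrightarrow> z \<in> open_cone x \<Longrightarrow> y + z \<in> open_cone x"
  by (simp add: closed_cone_def open_cone_def inner_add_right distrib_left add_nonneg_pos)

lemma chamber_scaleR: "0 < k \<Longrightarrow> chamber (k *\<^sub>R x) = chamber x"
  by (simp add: chamber_def closed_cone_def zero_le_mult_iff mult_le_0_iff)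

lemma open_cone_eq_Inter: "open_cone x = (\<Inter>p\<in>P. {y. 0 < ((p \<bullet> x) *\<^sub>R p) \<bullet> y})"
  by (auto simp: open_cone_def)

lemma open_open_cone: "open (open_cone x)"
  unfolding open_cone_eq_Inter by (intro open_INT finite_normals ballI open_halfspace_gt)

lemma convex_open_cone: "convex (open_cone x)"
  unfolding open_cone_eq_Inter by (intro convex_INT convex_halfspace_gt)

lemma closed_chamber: "closed (chamber x)"
proof -
  have "closed_cone x = (\<Inter>p\<in>P. {y. 0 \<le> ((p \<bullet> x) *\<^sub>R p) \<bullet> y})"
    by (auto simp: closed_cone_def)
  then show ?thesis
    unfolding chamber_def
    by (simp only:) (intro closed_Int closed_INT ballI closed_halfspace_ge closed_sphere)
qed

lemma sgn_in_open_cone: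
  assumes "y \<in> open_cone x"
  shows "sgn y \<in> open_cone x \<inter> sphere 0 1"
proof -
  have "y \<noteq> 0" using assms zero_notin_open_cone by auto
  then show ?thesis
    using assms open_cone_scaleR[of "inverse (norm y)" y x] norm_sgn[of y]
    by (simp add: sgn_div_norm)
qed

lemma connected_open_cone_sphere: "connected (open_cone x \<inter> sphere 0 1)"
proof -
  have "connected (sgn ` open_cone x)"
    using zero_notin_open_cone
    by (intro connected_continuous_image convex_connected convex_open_cone continuous_on_sgn
        continuous_on_id) auto
  moreover have "sgn ` open_cone x = open_cone x \<inter> sphere 0 1"
  proof (intro equalityI subsetI)
    fix y assume "y \<in> open_cone x \<inter> sphere 0 1"
    then show "y \<in> sgn ` open_cone x" by (auto simp: sgn_div_norm intro!: image_eqI[of _ _ y])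
  qed (use sgn_in_open_cone in blast)
  ultimately show ?thesis by simp
qed

lemma connected_generic_subset_open_cone:
  assumes K: "connected K" "K \<subseteq> {x. generic x}" and x: "x \<in> K"
  shows "K \<subseteq> open_cone x"
proof
  fix y assume y: "y \<in> K"
  have "0 < (p \<bullet> x) * (p \<bullet> y)" if "p \<in> P" for p
  proof -
    have "\<forall>z\<in>K. p \<bullet> z \<noteq> 0" using K(2) that by (auto simp: generic_def)
    then have "\<not> (p \<bullet> x \<le> 0 \<and> 0 \<le> p \<bullet> y)" "\<not> (p \<bullet> y \<le> 0 \<and> 0 \<le> p \<bullet> x)"
      using connected_ivt_hyperplane[OF K(1)] x y by blast+
    then show ?thesis by (auto simp: zero_less_mult_iff not_le)
  qed
  then show "y \<in> open_cone x" by (simp add: open_cone_def)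
qed

lemma connected_component_generic:
  assumes x: "x \<in> sphere 0 1" "generic x"
  shows "connected_component_set {x \<in> sphere 0 1. generic x} x = open_cone x \<inter> sphere 0 1"
    (is "connected_component_set ?U x = _")
proof
  have "open_cone x \<inter> sphere 0 1 \<subseteq> ?U" by (fastforce simp: open_cone_def generic_def)
  then show "open_cone x \<inter> sphere 0 1 \<subseteq> connected_component_set ?U x"
    using x generic_in_open_cone connected_open_cone_sphere
    by (intro connected_component_maximal) auto
  let ?K = "connected_component_set ?U x"
  have "?K \<subseteq> ?U" by (rule connected_component_subset)
  moreover have "x \<in> ?K" using x by simp
  ultimately show "?K \<subseteq> open_cone x \<inter> sphere 0 1"
    using connected_generic_subset_open_cone[OF connected_connected_component, of ?U x] by blast
qed

lemma closure_open_cone_sphere: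
  assumes "generic x"
  shows "closure (open_cone x \<inter> sphere 0 1) = chamber x"
proof
  show "closure (open_cone x \<inter> sphere 0 1) \<subseteq> chamber x"
    using open_cone_subset_closed_cone
    by (intro closure_minimal closed_chamber) (auto simp: chamber_def)
  show "chamber x \<subseteq> closure (open_cone x \<inter> sphere 0 1)"
  proof
    fix y assume y: "y \<in> chamber x"
    then have "norm y = 1" by (simp add: chamber_def)
    have "((\<lambda>e. sgn (y + e *\<^sub>R x)) \<longlongrightarrow> sgn (y + 0 *\<^sub>R x)) (at_right 0)"
      using \<open>norm y = 1\<close> by (intro tendsto_intros) auto
    then have lim: "((\<lambda>e. sgn (y + e *\<^sub>R x)) \<longlongrightarrow> y) (at_right 0)"
      using \<open>norm y = 1\<close> by (simp add: sgn_div_norm)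
    have "sgn (y + e *\<^sub>R x) \<in> open_cone x \<inter> sphere 0 1" if "0 < e" for e
    proof (intro sgn_in_open_cone closed_cone_add_open_cone)
      show "y \<in> closed_cone x" using y by (simp add: chamber_def)
      show "e *\<^sub>R x \<in> open_cone x"
        using that assms by (simp add: open_cone_scaleR generic_in_open_cone)
    qed
    then have "\<forall>\<^sub>F e in at_right 0. sgn (y + e *\<^sub>R x) \<in> closure (open_cone x \<inter> sphere 0 1)"
      by (intro eventually_mono[OF eventually_at_right_less[of "0::real"]]
          closure_subset[THEN subsetD])
    from Lim_in_closed_set[OF closed_closure this _ lim]
    show "y \<in> closure (open_cone x \<inter> sphere 0 1)" by simp
  qed
qed

lemma closure_components_generic: "closure ` components {x \<in> sphere 0 1. generic x} = chambers"
proof (intro equalityI subsetI)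
  fix T assume "T \<in> closure ` components {x \<in> sphere 0 1. generic x}"
  then obtain x where "x \<in> sphere 0 1" "generic x"
    "T = closure (connected_component_set {x \<in> sphere 0 1. generic x} x)"
    by (auto simp only: components_def image_iff mem_Collect_eq)
  then show "T \<in> chambers"
    by (simp only: connected_component_generic closure_open_cone_sphere) (simp add: chambers_def)
next
  fix T assume "T \<in> chambers"
  then obtain x where x: "generic x" "T = chamber x" by (rule chambers_cases)
  then have "x \<noteq> 0" by (simp add: generic_nonzero)
  then have sgn: "sgn x \<in> sphere 0 1" "generic (sgn x)" and T: "T = chamber (sgn x)"
    using x norm_sgn[of x] chamber_scaleR[of "inverse (norm x)" x]
    by (simp_all add: generic_def sgn_div_norm)
  have "T = closure (connected_component_set {x \<in> sphere 0 1. generic x} (sgn x))"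
    by (simp only: T connected_component_generic[OF sgn] closure_open_cone_sphere[OF sgn(2)])
  then show "T \<in> closure ` components {x \<in> sphere 0 1. generic x}"
    using sgn unfolding components_def by blast
qed

lemma generic_perturbation:
  assumes y: "norm y = 1" and w: "\<And>p. p \<in> P \<Longrightarrow> p \<bullet> y \<noteq> 0 \<or> p \<bullet> w \<noteq> 0"
  obtains e where "0 < e" "generic (y + e *\<^sub>R w)" "y \<in> chamber (y + e *\<^sub>R w)"
proof -
  define good where "good p e \<longleftrightarrow> p \<bullet> (y + e *\<^sub>R w) \<noteq> 0 \<and> 0 \<le> (p \<bullet> (y + e *\<^sub>R w)) * (p \<bullet> y)" for p e
  have pos: "\<forall>\<^sub>F e in at_right (0::real). 0 < e" by (simp add: eventually_at_right_less)
  have "\<forall>\<^sub>F e in at_right 0. good p e" if "p \<in> P" for p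
  proof (cases "p \<bullet> y = 0")
    case True
    then show ?thesis
      using w[OF that] by (intro eventually_mono[OF pos]) (simp add: good_def inner_add_right)
  next
    case False
    have "((\<lambda>e. (p \<bullet> (y + e *\<^sub>R w)) * (p \<bullet> y)) \<longlongrightarrow> (p \<bullet> (y + 0 *\<^sub>R w)) * (p \<bullet> y)) (at_right 0)"
      by (intro tendsto_intros)
    moreover have "0 < (p \<bullet> (y + 0 *\<^sub>R w)) * (p \<bullet> y)"
      using False by (simp add: power2_eq_square[symmetric])
    ultimately have "\<forall>\<^sub>F e in at_right 0. 0 < (p \<bullet> (y + e *\<^sub>R w)) * (p \<bullet> y)"
      by (rule order_tendstoD)
    then show ?thesis by (rule eventually_mono) (auto simp: good_def)
  qed
  then have "\<forall>\<^sub>F e in at_right 0. \<forall>p\<in>P. good p e"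
    by (intro eventually_ball_finite finite_normals) blast
  from eventually_happens'[OF trivial_limit_at_right_real eventually_conj[OF pos this]]
  obtain e where "0 < e" "\<forall>p\<in>P. good p e" by blast
  then show ?thesis
    using that[of e] y by (simp add: good_def generic_def chamber_def closed_cone_def)
qed

lemma vertex_summand_in_span:
  assumes "generic x" "vertex v" "v = y + z" "y \<in> closed_cone x" "z \<in> closed_cone x"
  shows "y \<in> span {v}"
proof -
  have "p \<bullet> y = 0" if p: "p \<in> P" "p \<bullet> v = 0" for p
  proof -
    have "(p \<bullet> x) * (p \<bullet> y) + (p \<bullet> x) * (p \<bullet> z) = 0"
      using p(2) by (simp add: assms(3) inner_add_right flip: distrib_left)
    moreover have "0 \<le> (p \<bullet> x) * (p \<bullet> y)" "0 \<le> (p \<bullet> x) * (p \<bullet> z)"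
      using assms(4,5) p(1) by (simp_all add: closed_cone_def)
    ultimately have "(p \<bullet> x) * (p \<bullet> y) = 0" by linarith
    then show ?thesis using assms(1) p(1) by (simp add: generic_def)
  qed
  then show ?thesis using assms(2) unfolding vertex_def by blast
qed

end

section \<open>Triangular chambers\<close>

locale great_circle_arrangement = central_arrangement P for P :: "(real ^ 3) set" +
  assumes normal_nonzero: "0 \<notin> P"
begin

lemma vertex_if_on_two_circles:
  assumes "p \<in> P" "q \<in> P" "norm v = 1" "p \<bullet> v = 0" "q \<bullet> v = 0"
    and ne: "{x \<in> sphere 0 1. p \<bullet> x = 0} \<noteq> {x \<in> sphere 0 1. q \<bullet> x = 0}"
  shows "vertex v"
proof -
  have "x \<in> span {v}" if x: "\<forall>p\<in>P. p \<bullet> v = 0 \<longrightarrow> p \<bullet> x = 0" for x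
  proof -
    have parallel: "\<exists>k. k \<noteq> 0 \<and> v \<times> x = k *\<^sub>R p" if "v \<times> x \<noteq> 0" "p \<in> P" "p \<bullet> v = 0" for p
    proof -
      have "p \<times> (v \<times> x) = 0" using x that by (simp add: Lagrange)
      moreover have "p \<noteq> 0" using that normal_nonzero by blast
      ultimately obtain k where "v \<times> x = k *\<^sub>R p"
        using that(1) by (auto simp: cross_eq_0[of p] collinear_lemma)
      then show ?thesis using that(1) by auto
    qed
    have "v \<times> x = 0"
    proof (rule ccontr)
      assume "v \<times> x \<noteq> 0"
      then obtain k l where "k \<noteq> 0" "v \<times> x = k *\<^sub>R p" "l \<noteq> 0" "v \<times> x = l *\<^sub>R q"
        using parallel assms by metis
      then have "p \<bullet> y = 0 \<longleftrightarrow> q \<bullet> y = 0" for y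
        by (metis inner_scaleR_left mult_eq_0_iff)
      then show False using ne by simp
    qed
    then show ?thesis
      using \<open>norm v = 1\<close> by (auto simp: cross_eq_0 collinear_lemma span_singleton)
  qed
  then show ?thesis using \<open>norm v = 1\<close> unfolding vertex_def by blast
qed

lemma closed_cone_triangle_coords:
  assumes T: "has_corners (chamber x) a b c" and y: "y \<in> closed_cone x"
  obtains s t u where "0 \<le> s" "0 \<le> t" "0 \<le> u" "y = s *\<^sub>R a + t *\<^sub>R b + u *\<^sub>R c"
proof (cases "y = 0")
  case True
  then show ?thesis using that[of 0 0 0] by simp
next
  case False
  then have "sgn y \<in> chamber x"
    using y closed_cone_scaleR[of "inverse (norm y)" y x] norm_sgn[of y]
    by (simp add: chamber_def sgn_div_norm)
  then obtain s t u where stu: "0 \<le> s" "0 \<le> t" "0 \<le> u" "sgn y = s *\<^sub>R a + t *\<^sub>R b + u *\<^sub>R c"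
    unfolding has_cornersD(2)[OF T] triangle_region_def by blast
  have "y = norm y *\<^sub>R sgn y" using False by (simp add: sgn_div_norm)
  then have "y = (norm y * s) *\<^sub>R a + (norm y * t) *\<^sub>R b + (norm y * u) *\<^sub>R c"
    by (simp add: stu(4) scaleR_add_right)
  then show ?thesis using that[of "norm y * s" "norm y * t" "norm y * u"] stu(1-3) by simp
qed

lemma corners_subset_closed_cone: "has_corners (chamber x) a b c \<Longrightarrow> {a, b, c} \<subseteq> closed_cone x"
  using has_cornersD(3)[of "chamber x" a b c] by (simp add: chamber_def)

text \<open>If no circle contained both \<open>a\<close> and \<open>b\<close>, then \<open>a + b\<close> would be an interior point of the
  cone over the triangle, and so the cone would reach beyond the edge \<open>ab\<close>.\<close>

lemma edge_on_circle:
  assumes x: "generic x" and T: "has_corners (chamber x) a b c"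
  shows "\<exists>p\<in>P. p \<bullet> a = 0 \<and> p \<bullet> b = 0"
proof (rule ccontr)
  assume none: "\<not> ?thesis"
  have "a + b \<in> open_cone x"
    unfolding open_cone_def
  proof (intro CollectI ballI)
    fix p assume p: "p \<in> P"
    then have "p \<bullet> x \<noteq> 0" "p \<bullet> a \<noteq> 0 \<or> p \<bullet> b \<noteq> 0"
      using x none by (auto simp: generic_def)
    moreover have nonneg: "0 \<le> (p \<bullet> x) * (p \<bullet> a)" "0 \<le> (p \<bullet> x) * (p \<bullet> b)"
      using corners_subset_closed_cone[OF T] p by (auto simp: closed_cone_def)
    ultimately have "(p \<bullet> x) * (p \<bullet> a) + (p \<bullet> x) * (p \<bullet> b) \<noteq> 0"
      by (simp only: add_nonneg_eq_0_iff mult_eq_0_iff) simp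
    then show "0 < (p \<bullet> x) * (p \<bullet> (a + b))"
      using nonneg unfolding inner_add_right distrib_left by linarith
  qed
  moreover have "((\<lambda>e. a + b - e *\<^sub>R c) \<longlongrightarrow> a + b - 0 *\<^sub>R c) (at_right 0)"
    by (intro tendsto_intros)
  ultimately have "\<forall>\<^sub>F e in at_right 0. a + b - e *\<^sub>R c \<in> open_cone x"
    using topological_tendstoD[OF _ open_open_cone] by simp
  then have "\<forall>\<^sub>F e in at_right 0. 0 < e \<and> a + b - e *\<^sub>R c \<in> open_cone x"
    by (intro eventually_conj) (simp_all add: eventually_at_right_less)
  then obtain e where e: "0 < e" "a + b - e *\<^sub>R c \<in> open_cone x"
    using eventually_happens'[OF trivial_limit_at_right_real] by blast
  then have "a + b - e *\<^sub>R c \<in> closed_cone x" using open_cone_subset_closed_cone by blast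
  then obtain s t u where "0 \<le> u" "a + b - e *\<^sub>R c = s *\<^sub>R a + t *\<^sub>R b + u *\<^sub>R c"
    by (rule closed_cone_triangle_coords[OF T])
  then have "(s - 1) *\<^sub>R a + (t - 1) *\<^sub>R b + (u + e) *\<^sub>R c = 0" by (simp add: algebra_simps)
  from triangle_corners_independent(3)[OF has_cornersD(1)[OF T] this]
  show False using e(1) \<open>0 \<le> u\<close> by simp
qed

lemma corner_vertex:
  assumes x: "generic x" and T: "has_corners (chamber x) a b c"
  shows "vertex a"
  unfolding vertex_def
proof (intro conjI allI impI)
  note tri = has_cornersD(1)[OF T]
  show "norm a = 1" using triangle_corners_norm[OF tri] by simp
  obtain p where p: "p \<in> P" "p \<bullet> a = 0" "p \<bullet> b = 0" using edge_on_circle[OF x T] by blast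
  obtain q where q: "q \<in> P" "q \<bullet> a = 0" "q \<bullet> c = 0"
    using edge_on_circle[OF x] T has_corners_commute by blast
  have "p \<bullet> c \<noteq> 0" "q \<bullet> b \<noteq> 0"
    using triangle_corners_orthogonal_imp_0[OF tri] p q normal_nonzero by blast+
  fix y assume y: "\<forall>p\<in>P. p \<bullet> a = 0 \<longrightarrow> p \<bullet> y = 0"
  obtain s t u where stu: "y = s *\<^sub>R a + t *\<^sub>R b + u *\<^sub>R c"
    by (rule triangle_corners_coords[OF tri])
  have "p \<bullet> y = 0" "q \<bullet> y = 0" using y p q by blast+
  then have "u = 0" "t = 0"
    using p q \<open>p \<bullet> c \<noteq> 0\<close> \<open>q \<bullet> b \<noteq> 0\<close> by (simp_all add: stu inner_add_right)
  then show "y \<in> span {a}" by (simp add: stu span_base span_scale)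
qed

lemma vertex_eq_corner:
  assumes x: "generic x" and T: "has_corners (chamber x) a b c" and v: "vertex v"
    and stu: "0 < s" "0 \<le> t" "0 \<le> u" "v = s *\<^sub>R a + t *\<^sub>R b + u *\<^sub>R c"
  shows "v = a"
proof -
  have "a \<in> closed_cone x" "b \<in> closed_cone x" "c \<in> closed_cone x"
    using corners_subset_closed_cone[OF T] by simp_all
  then have "s *\<^sub>R a \<in> closed_cone x" "t *\<^sub>R b + u *\<^sub>R c \<in> closed_cone x"
    using stu(1-3) by (simp_all add: closed_cone_add closed_cone_scaleR)
  moreover have "v = s *\<^sub>R a + (t *\<^sub>R b + u *\<^sub>R c)" using stu(4) by (simp add: add.assoc)
  ultimately have "s *\<^sub>R a \<in> span {v}" using vertex_summand_in_span[OF x v] by blast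
  then obtain k where "s *\<^sub>R a = k *\<^sub>R v" by (auto simp: span_singleton)
  then have "(k * s - s) *\<^sub>R a + (k * t) *\<^sub>R b + (k * u) *\<^sub>R c = 0"
    by (simp add: stu(4) algebra_simps)
  from triangle_corners_independent[OF has_cornersD(1)[OF T] this]
  have "v = s *\<^sub>R a" using stu(1,4) by auto
  moreover have "norm v = 1" using v by (simp add: vertex_def)
  ultimately show ?thesis using stu(1) triangle_corners_norm(1)[OF has_cornersD(1)[OF T]] by simp
qed

lemma vertex_in_chamber:
  assumes x: "generic x" and T: "has_corners (chamber x) a b c" and v: "vertex v" "v \<in> chamber x"
  shows "v \<in> {a, b, c}"
proof -
  obtain s t u where stu: "0 \<le> s" "0 \<le> t" "0 \<le> u" "v = s *\<^sub>R a + t *\<^sub>R b + u *\<^sub>R c"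
    using v(2) unfolding has_cornersD(2)[OF T] triangle_region_def by blast
  have T': "has_corners (chamber x) b a c" "has_corners (chamber x) c a b"
    using T has_corners_commute by blast+
  have v': "v = t *\<^sub>R b + s *\<^sub>R a + u *\<^sub>R c" "v = u *\<^sub>R c + s *\<^sub>R a + t *\<^sub>R b"
    using stu(4) by (simp_all add: add_ac)
  have "v \<noteq> 0" using v(1) by (auto simp: vertex_def)
  then consider "0 < s" | "0 < t" | "0 < u" using stu by fastforce
  then show ?thesis
  proof cases
    case 1
    then show ?thesis using vertex_eq_corner[OF x T v(1) _ _ _ stu(4)] stu by simp
  next
    case 2
    then show ?thesis using vertex_eq_corner[OF x T'(1) v(1) _ _ _ v'(1)] stu by simp
  next
    case 3
    then show ?thesis using vertex_eq_corner[OF x T'(2) v(1) _ _ _ v'(2)] stu by simp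
  qed
qed

lemma corners_eq_vertices:
  assumes x: "generic x" and T: "has_corners (chamber x) a b c"
  shows "{a, b, c} = {v \<in> chamber x. vertex v}"
proof -
  have "has_corners (chamber x) b a c" "has_corners (chamber x) c a b"
    using T has_corners_commute by blast+
  then have "vertex a" "vertex b" "vertex c" using corner_vertex[OF x] T by blast+
  moreover note has_cornersD(3)[OF T]
  ultimately show ?thesis using vertex_in_chamber[OF assms] by blast
qed

lemma vertex_ending_side:
  assumes T: "T \<in> chambers" "has_corners T v b c"
    and w: "vertex w" "w = k *\<^sub>R v + l *\<^sub>R b" "0 \<le> k" "0 < l"
  shows "w = b"
proof -
  obtain x where x: "generic x" "T = chamber x" using T(1) by (rule chambers_cases)
  note tri = has_cornersD(1,2)[OF T(2)]
  have "norm w = 1" using w(1) by (simp add: vertex_def)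
  moreover have "w = k *\<^sub>R v + l *\<^sub>R b + 0 *\<^sub>R c" using w(2) by simp
  ultimately have "w \<in> T"
    using w(3) less_imp_le[OF w(4)] order_refl[of "0::real"] unfolding tri(2) triangle_region_def
    by (simp only: mem_Collect_eq mem_sphere_0) metis
  then have "w \<in> {v, b, c}" using vertex_in_chamber[OF x(1) T(2)[unfolded x(2)] w(1)] x(2) by simp
  moreover have "w \<noteq> v"
  proof
    assume "w = v"
    then have "(k - 1) *\<^sub>R v + l *\<^sub>R b + 0 *\<^sub>R c = 0" using w(2) by (simp add: algebra_simps)
    from triangle_corners_independent(2)[OF tri(1) this] show False using w(4) by simp
  qed
  moreover have "w \<noteq> c"
  proof
    assume "w = c"
    then have "k *\<^sub>R v + l *\<^sub>R b + (- 1) *\<^sub>R c = 0" using w(2) by simp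
    from triangle_corners_independent(3)[OF tri(1) this] show False by simp
  qed
  ultimately show ?thesis by blast
qed

end

section \<open>The sectors at a vertex\<close>

lemma tangent_plane_frame:
  fixes v :: "real ^ 3"
  assumes "v \<noteq> 0"
  obtains e1 e2 where "orthonormal_pair e1 e2" "span {e1, e2} = {w. v \<bullet> w = 0}"
proof -
  obtain B where B: "pairwise orthogonal B" "\<And>x. x \<in> B \<Longrightarrow> norm x = 1"
    "card B = dim {w. v \<bullet> w = 0}" "span B = {w. v \<bullet> w = 0}"
    using orthonormal_basis_subspace[OF subspace_hyperplane[of v]] by metis
  have "dim {w. v \<bullet> w = 0} = 2" using dim_hyperplane[OF assms] by simp
  then obtain e1 e2 where e: "B = {e1, e2}" "e1 \<noteq> e2" using B(3) by (auto simp: card_2_iff)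
  then have "orthonormal_pair e1 e2"
    using B(1,2) by unfold_locales (auto simp: pairwise_def orthogonal_def)
  then show ?thesis using that B(4) e(1) by blast
qed

lemma tangent_part_decomp: "x = (v \<bullet> x) *\<^sub>R v + tangent_part v x"
  by (simp add: tangent_part_def)

lemma inner_tangent_part: "p \<bullet> v = 0 \<Longrightarrow> p \<bullet> tangent_part v x = p \<bullet> x"
  by (simp add: tangent_part_def inner_diff_right)

lemma tangent_parts_independent:
  assumes tri: "triangle_corners v b c" and "p *\<^sub>R tangent_part v b + q *\<^sub>R tangent_part v c = 0"
  shows "p = 0"
proof -
  have "(- (p * (v \<bullet> b)) - q * (v \<bullet> c)) *\<^sub>R v + p *\<^sub>R b + q *\<^sub>R c = 0"
    using assms(2) by (simp add: tangent_part_def algebra_simps)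
  then show ?thesis by (rule triangle_corners_independent(2)[OF tri])
qed

locale vertex_frame = great_circle_arrangement P + orthonormal_pair e1 e2
  for P :: "(real ^ 3) set" and v e1 e2 :: "real ^ 3" +
  assumes vertex_v: "vertex v"
    and tangent_plane: "span {e1, e2} = {w. v \<bullet> w = 0}"
    and triangular: "\<And>x. generic x \<Longrightarrow> spherical_triangle (chamber x)"
begin

definition circle_dirs :: "real set" where
  "circle_dirs = {t. \<exists>p\<in>P. p \<bullet> v = 0 \<and> p \<bullet> dir t = 0}"

definition consecutive :: "real \<Rightarrow> real \<Rightarrow> bool" where
  "consecutive s s' \<longleftrightarrow> s \<in> circle_dirs \<and> s' \<in> circle_dirs \<and> s < s' \<and> circle_dirs \<inter> {s<..<s'} = {}"

definition in_direction :: "real ^ 3 \<Rightarrow> real \<Rightarrow> bool" where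
  "in_direction x t \<longleftrightarrow> (\<exists>r>0. tangent_part v x = r *\<^sub>R dir t)"

definition sector :: "real \<Rightarrow> real \<Rightarrow> (real ^ 3) set \<Rightarrow> real ^ 3 \<Rightarrow> real ^ 3 \<Rightarrow> bool" where
  "sector s s' T b c \<longleftrightarrow> T \<in> chambers \<and> has_corners T v b c \<and> in_direction b s \<and> in_direction c s'"

lemma norm_v: "norm v = 1"
  using vertex_v by (simp add: vertex_def)

lemma inner_v_dir: "v \<bullet> dir t = 0"
proof -
  have "dir t \<in> span {e1, e2}" by (simp add: dir_def span_add span_base span_scale)
  then show ?thesis using tangent_plane by simp
qed

lemma inner_in_direction:
  assumes "in_direction x t" "p \<bullet> v = 0"
  obtains r where "0 < r" "p \<bullet> x = r * (p \<bullet> dir t)"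
proof -
  obtain r where r: "0 < r" "tangent_part v x = r *\<^sub>R dir t"
    using assms(1) by (auto simp: in_direction_def)
  then have "p \<bullet> x = r * (p \<bullet> dir t)" using inner_tangent_part[OF assms(2), of x] by simp
  then show ?thesis using that r(1) by blast
qed

lemma direction_exists:
  assumes "tangent_part v x \<noteq> 0"
  obtains t where "in_direction x t" "s \<le> t" "t < s + 2 * pi"
proof -
  have "tangent_part v x \<in> span {e1, e2}"
    using norm_v by (simp add: tangent_plane tangent_part_def inner_diff_right dot_square_norm)
  then obtain r t where "0 < r" "tangent_part v x = r *\<^sub>R dir t" "s \<le> t" "t < s + 2 * pi"
    using assms by (rule polar_coordinates)
  then show ?thesis using that by (auto simp: in_direction_def)
qed

lemma normal_inner_dir:
  assumes "p \<in> P" "p \<bullet> v = 0" "p \<bullet> dir s = 0"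
  obtains R where "R \<noteq> 0" "\<And>t. p \<bullet> dir t = R * sin (t - s)"
proof (rule inner_dir_eq_sin)
  show "p \<in> span {e1, e2}" using assms(2) by (simp add: tangent_plane inner_commute)
  show "p \<noteq> 0" using assms(1) normal_nonzero by blast
qed (use assms that in auto)

lemma circle_through_v: "\<exists>p\<in>P. p \<bullet> v = 0"
proof (rule ccontr)
  assume "\<not> ?thesis"
  then have "e1 \<in> span {v}" using vertex_v by (auto simp: vertex_def)
  moreover have "v \<bullet> e1 = 0" using inner_v_dir[of 0] by (simp add: dir_def)
  ultimately show False using orthonormal norm_v by (auto simp: span_singleton)
qed

lemma circle_dirs_plus_pi: "t + pi \<in> circle_dirs \<longleftrightarrow> t \<in> circle_dirs"
  by (simp add: circle_dirs_def dir_plus_pi)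

lemma circle_dirs_nonempty: "circle_dirs \<noteq> {}"
proof -
  obtain p where p: "p \<in> P" "p \<bullet> v = 0" using circle_through_v by blast
  then have "p \<in> span {e1, e2}" "p \<noteq> 0"
    using normal_nonzero by (auto simp: tangent_plane inner_commute)
  then obtain r t where "p = r *\<^sub>R dir t" by (rule polar_coordinates)
  then have "p \<bullet> dir (t + pi / 2) = 0" by (simp add: inner_dir)
  then show ?thesis using p by (auto simp: circle_dirs_def)
qed

lemma finite_circle_dirs: "finite (circle_dirs \<inter> {s..<s + pi})"
proof -
  have "\<forall>t\<in>circle_dirs. \<exists>p. p \<in> P \<and> p \<bullet> v = 0 \<and> p \<bullet> dir t = 0"
    by (auto simp: circle_dirs_def)
  then obtain N where N: "\<forall>t\<in>circle_dirs. N t \<in> P \<and> N t \<bullet> v = 0 \<and> N t \<bullet> dir t = 0"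
    by (rule bchoice[THEN exE])
  have "inj_on N (circle_dirs \<inter> {s..<s + pi})"
  proof (rule inj_onI)
    fix t u assume tu: "t \<in> circle_dirs \<inter> {s..<s + pi}" "u \<in> circle_dirs \<inter> {s..<s + pi}" "N t = N u"
    obtain R where "R \<noteq> 0" "\<And>w. N t \<bullet> dir w = R * sin (w - t)"
      by (rule normal_inner_dir[of "N t" t]) (use N tu in auto)
    moreover have "N t \<bullet> dir u = 0" using N tu by auto
    ultimately have "sin (u - t) = 0" by simp
    then show "t = u" using sin_eq_0_pi[of "u - t"] tu by simp
  qed
  moreover have "N ` (circle_dirs \<inter> {s..<s + pi}) \<subseteq> P" using N by auto
  ultimately show ?thesis using finite_normals by (rule inj_on_finite)
qed

lemma consecutive_le_pi: "consecutive s s' \<Longrightarrow> s' \<le> s + pi"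
  using circle_dirs_plus_pi[of s] by (fastforce simp: consecutive_def)

lemma consecutive_dirs_exist:
  obtains f :: "nat \<Rightarrow> real" and n where "0 < n" "\<And>i. consecutive (f i) (f (Suc i))"
    "\<And>i. f (i + n) = f i + pi"
    "\<And>m. f 0 \<le> m \<Longrightarrow> m \<notin> circle_dirs \<Longrightarrow> \<exists>i. f i < m \<and> m < f (Suc i)"
proof -
  obtain s where "s \<in> circle_dirs" using circle_dirs_nonempty by blast
  then obtain f :: "nat \<Rightarrow> real" and n where n: "0 < n" and mono: "strict_mono f"
    and range: "range f = circle_dirs \<inter> {s..}" and periodic: "\<And>i. f (i + n) = f i + pi"
    using periodic_set_enumeration[OF pi_gt_zero circle_dirs_plus_pi _ finite_circle_dirs] by metis
  have mem: "f i \<in> circle_dirs" "s \<le> f i" for i using range by auto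
  have gap: "t \<notin> circle_dirs" if "f i < t" "t < f (Suc i)" for i t
  proof
    assume "t \<in> circle_dirs"
    moreover have "s \<le> t" using mem(2)[of i] that by simp
    ultimately obtain j where "t = f j" using range by blast
    then show False using that by (simp add: strict_mono_less[OF mono])
  qed
  have "consecutive (f i) (f (Suc i))" for i
    using mem gap mono by (auto simp: consecutive_def strict_mono_Suc_iff)
  moreover have "\<exists>i. f i < m \<and> m < f (Suc i)" if m: "f 0 \<le> m" "m \<notin> circle_dirs" for m
  proof -
    have "f (0 + k * n) = f 0 + real k * pi" for k
      by (induction k) (use periodic[of "l * n" for l] in \<open>simp_all add: algebra_simps\<close>)
    moreover obtain k where "m - f 0 < real k * pi"
      using reals_Archimedean3[OF pi_gt_zero] by blast
    ultimately have "m < f (0 + k * n)" by simp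
    with m(1) obtain i where "f i \<le> m" "m < f (Suc i)" by (rule strict_mono_unbounded_bracket)
    moreover have "f i \<noteq> m" using m(2) mem by blast
    ultimately show ?thesis by (auto simp: less_le)
  qed
  ultimately show ?thesis using that n periodic by blast
qed

lemma chamber_at_vertex:
  assumes x: "generic x" and "v \<in> chamber x"
  obtains b c where "has_corners (chamber x) v b c"
proof -
  obtain a b c where T: "has_corners (chamber x) a b c"
    using triangular[OF x] unfolding spherical_triangle_def has_corners_def by blast
  then have "v \<in> {a, b, c}" using vertex_in_chamber[OF x T vertex_v] assms(2) by blast
  moreover have "has_corners (chamber x) b a c" "has_corners (chamber x) c a b"
    using T has_corners_commute by blast+
  ultimately show ?thesis using that T by blast
qed

lemma generic_direction_notin_circle_dirs:
  assumes "generic x" "in_direction x m"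
  shows "m \<notin> circle_dirs"
proof
  assume "m \<in> circle_dirs"
  then obtain p where p: "p \<in> P" "p \<bullet> v = 0" "p \<bullet> dir m = 0" by (auto simp: circle_dirs_def)
  then have "p \<bullet> x = 0" using inner_in_direction[OF assms(2) p(2)] by (metis mult_zero_right)
  then show False using assms(1) p(1) by (simp add: generic_def)
qed

lemma same_side:
  assumes x: "in_direction x m" and z: "z \<in> chamber x" "in_direction z u" and t: "t \<in> circle_dirs"
  shows "0 \<le> sin (m - t) * sin (u - t)"
proof -
  obtain p where p: "p \<in> P" "p \<bullet> v = 0" "p \<bullet> dir t = 0" using t by (auto simp: circle_dirs_def)
  obtain R where R: "R \<noteq> 0" "\<And>w. p \<bullet> dir w = R * sin (w - t)" using normal_inner_dir[OF p] by blast
  obtain r where r: "0 < r" "p \<bullet> x = r * (p \<bullet> dir m)" by (rule inner_in_direction[OF x p(2)])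
  obtain q where q: "0 < q" "p \<bullet> z = q * (p \<bullet> dir u)" by (rule inner_in_direction[OF z(2) p(2)])
  have "0 \<le> (p \<bullet> x) * (p \<bullet> z)" using z(1) p(1) by (simp add: chamber_def closed_cone_def)
  also have "\<dots> = (r * q * R\<^sup>2) * (sin (m - t) * sin (u - t))"
    by (simp add: r(2) q(2) R(2) power2_eq_square)
  finally show ?thesis
    using mult_le_cancel_left_pos[of "r * q * R\<^sup>2" 0] r(1) q(1) R(1) by simp
qed

lemma side_direction:
  assumes x: "generic x" "in_direction x m" and T: "has_corners (chamber x) v b c"
    and s: "consecutive s s'" "s < m" "m < s'"
  shows "in_direction b s \<or> in_direction b s'"
proof -
  have "tangent_part v b \<noteq> 0"
    using tangent_parts_independent[OF has_cornersD(1)[OF T], of 1 0] by auto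
  then obtain t where t: "in_direction b t" "s \<le> t" "t < s + 2 * pi" by (rule direction_exists)
  obtain p where p: "p \<in> P" "p \<bullet> v = 0" "p \<bullet> b = 0" using edge_on_circle[OF x(1) T] by blast
  obtain r where "0 < r" "p \<bullet> b = r * (p \<bullet> dir t)" by (rule inner_in_direction[OF t(1) p(2)])
  then have "t \<in> circle_dirs" using p by (auto simp: circle_dirs_def)
  have b: "b \<in> chamber x" using has_cornersD(3)[OF T] by simp
  have "t \<le> s'"
    using same_side[OF x(2) b t(1)] s consecutive_le_pi[OF s(1)] t(2,3)
    by (intro angle_le_if_same_side[of s m s' t]) (auto simp: consecutive_def)
  then have "t = s \<or> t = s'"
    using t(2) s(1) \<open>t \<in> circle_dirs\<close> by (force simp: consecutive_def)
  then show ?thesis using t(1) by blast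
qed

lemma side_directions_distinct:
  assumes T: "has_corners T v b c" and "in_direction b t" "in_direction c u"
  shows "t \<noteq> u"
proof
  assume "t = u"
  then obtain r q where "0 < q" "tangent_part v b = r *\<^sub>R dir t" "tangent_part v c = q *\<^sub>R dir t"
    using assms(2,3) by (auto simp: in_direction_def)
  then have "q *\<^sub>R tangent_part v b + (- r) *\<^sub>R tangent_part v c = 0" by simp
  then show False using tangent_parts_independent[OF has_cornersD(1)[OF T]] \<open>0 < q\<close> by fastforce
qed

lemma sector_exists:
  assumes x: "generic x" "v \<in> chamber x" "in_direction x m"
    and s: "consecutive s s'" "s < m" "m < s'"
  shows "\<exists>b c. sector s s' (chamber x) b c"
proof -
  obtain b c where T: "has_corners (chamber x) v b c" using chamber_at_vertex[OF x(1,2)] by blast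
  then have T': "has_corners (chamber x) v c b" using has_corners_commute by blast
  have "in_direction b s \<or> in_direction b s'" "in_direction c s \<or> in_direction c s'"
    using side_direction[OF x(1,3) _ s] T T' by blast+
  then consider "in_direction b s" "in_direction c s'" | "in_direction c s" "in_direction b s'"
    using side_directions_distinct[OF T] by blast
  moreover have "chamber x \<in> chambers" using x(1) by (simp add: chambers_def)
  ultimately show ?thesis using T T' unfolding sector_def by cases blast+
qed

lemma sector_between:
  assumes s: "consecutive s s'"
  shows "\<exists>T b c. sector s s' T b c"
proof -
  define m where "m = (s + s') / 2"
  have m: "s < m" "m < s'" and "m \<notin> circle_dirs" using s by (auto simp: m_def consecutive_def)
  then have "p \<bullet> v \<noteq> 0 \<or> p \<bullet> dir m \<noteq> 0" if "p \<in> P" for p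
    using that by (auto simp: circle_dirs_def)
  then obtain e where e: "0 < e" "generic (v + e *\<^sub>R dir m)" "v \<in> chamber (v + e *\<^sub>R dir m)"
    by (rule generic_perturbation[OF norm_v])
  have "in_direction (v + e *\<^sub>R dir m) m"
    using e(1) norm_v
    by (auto simp: in_direction_def tangent_part_def inner_add_right inner_v_dir dot_square_norm)
  then show ?thesis using sector_exists[OF e(2,3) _ s m] by blast
qed

lemma generic_has_direction:
  assumes x: "generic x"
  obtains m where "in_direction x m" "s \<le> m" "m < s + 2 * pi"
proof (rule direction_exists)
  obtain p where p: "p \<in> P" "p \<bullet> v = 0" using circle_through_v by blast
  show "tangent_part v x \<noteq> 0"
    using inner_tangent_part[OF p(2), of x] x p(1) by (auto simp: generic_def)
qed

lemma sector_angle: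
  assumes S: "sector s s' T b c" and s: "consecutive s s'"
  shows "corner_angle v b c = s' - s" "s' < s + pi"
proof -
  have le: "s < s'" "s' \<le> s + pi" using s consecutive_le_pi by (auto simp: consecutive_def)
  obtain r r' where r: "0 < r" "0 < r'" "tangent_part v b = r *\<^sub>R dir s"
    "tangent_part v c = r' *\<^sub>R dir s'"
    using S by (auto simp: sector_def in_direction_def)
  show "corner_angle v b c = s' - s"
    using r le by (simp add: corner_angle_def norm_dir inner_dir arccos_cos)
  have "s' \<noteq> s + pi"
  proof
    assume "s' = s + pi"
    then have "r' *\<^sub>R tangent_part v b + r *\<^sub>R tangent_part v c = 0"
      using r by (simp add: dir_plus_pi)
    moreover have "triangle_corners v b c" using S has_cornersD(1) by (auto simp: sector_def)
    ultimately show False using tangent_parts_independent r(2) by fastforce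
  qed
  then show "s' < s + pi" using le by simp
qed

lemma side_unique:
  assumes T: "T \<in> chambers" "has_corners T v b c" and T': "T' \<in> chambers" "has_corners T' v b' c'"
    and "in_direction b t" "in_direction b' t"
  shows "b = b'"
proof -
  obtain r r' where r: "0 < r" "tangent_part v b = r *\<^sub>R dir t"
    and r': "0 < r'" "tangent_part v b' = r' *\<^sub>R dir t"
    using assms(5,6) by (auto simp: in_direction_def)
  define p p' where "p = v \<bullet> b" and "p' = v \<bullet> b'"
  have b: "b = p *\<^sub>R v + r *\<^sub>R dir t" and b': "b' = p' *\<^sub>R v + r' *\<^sub>R dir t"
    using tangent_part_decomp[of b v] tangent_part_decomp[of b' v] r r'
    by (simp_all add: p_def p'_def)
  have vertex: "vertex b" if "T \<in> chambers" "has_corners T v b c" for T b c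
    using that corner_vertex[of _ b v c] has_corners_commute(1)[of T v b c]
    by (auto elim!: chambers_cases)
  show ?thesis
  proof (cases "p / r \<le> p' / r'")
    case True
    have "b' = (r' * (p' / r' - p / r)) *\<^sub>R v + (r' / r) *\<^sub>R b"
      using r(1) r'(1) unfolding b b' by (simp add: algebra_simps)
    from vertex_ending_side[OF T vertex[OF T'] this] show ?thesis using True r(1) r'(1) by simp
  next
    case False
    have "b = (r * (p / r - p' / r')) *\<^sub>R v + (r / r') *\<^sub>R b'"
      using r(1) r'(1) unfolding b b' by (simp add: algebra_simps)
    from vertex_ending_side[OF T' vertex[OF T] this] show ?thesis using False r(1) r'(1) by simp
  qed
qed

lemma adjacent_sectors:
  assumes "sector s s' T b c" "sector s' s'' T' b' c'"
  shows "c = b'"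
  using assms side_unique[of T c b T' b' c' s'] has_corners_commute(2)[of T v b c]
  by (simp add: sector_def)

lemma sector_sequence:
  obtains f :: "nat \<Rightarrow> real" and n S B where "0 < n" "\<And>i. consecutive (f i) (f (Suc i))"
    "\<And>i. f (i + n) = f i + pi" "\<And>i. sector (f i) (f (Suc i)) (S i) (B i) (B (Suc i))"
    "\<And>T. T \<in> chambers \<Longrightarrow> v \<in> T \<Longrightarrow> \<exists>i b c. sector (f i) (f (Suc i)) T b c"
proof -
  obtain f n where n: "0 < n" and consec: "\<And>i. consecutive (f i) (f (Suc i))"
    and periodic: "\<And>i. f (i + n) = f i + pi"
    and cover: "\<And>m. f 0 \<le> m \<Longrightarrow> m \<notin> circle_dirs \<Longrightarrow> \<exists>i. f i < m \<and> m < f (Suc i)"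
    by (rule consecutive_dirs_exist) blast
  obtain S B C where S: "\<And>i. sector (f i) (f (Suc i)) (S i) (B i) (C i)"
    using sector_between[OF consec] by metis
  have "C i = B (Suc i)" for i by (rule adjacent_sectors[OF S S])
  then have "sector (f i) (f (Suc i)) (S i) (B i) (B (Suc i))" for i using S[of i] by simp
  moreover have "\<exists>i b c. sector (f i) (f (Suc i)) T b c" if T: "T \<in> chambers" "v \<in> T" for T
  proof -
    obtain x where x: "generic x" "T = chamber x" using T(1) by (rule chambers_cases)
    obtain m where m: "in_direction x m" "f 0 \<le> m" using generic_has_direction[OF x(1)] by metis
    then obtain i where "f i < m" "m < f (Suc i)"
      using cover generic_direction_notin_circle_dirs[OF x(1)] by blast
    then show ?thesis using sector_exists[OF x(1) _ m(1) consec] T(2) x(2) by blast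
  qed
  ultimately show ?thesis using that n consec periodic by blast
qed

end

section \<open>Arrangements with congruent cells\<close>

locale congruent_arrangement = great_circle_arrangement P for P :: "(real ^ 3) set" +
  fixes M :: "real multiset"
  assumes chamber_side_cosines: "\<And>T. T \<in> chambers \<Longrightarrow> has_side_cosines T M"
begin

lemma side_cosines_eq:
  assumes T: "T \<in> chambers" "has_corners T p q r"
  shows "side_cosines p q r = M"
proof -
  obtain x where x: "generic x" "T = chamber x" using T(1) by (rule chambers_cases)
  obtain a b c where abc: "has_corners T a b c" "side_cosines a b c = M"
    using chamber_side_cosines[OF T(1)] unfolding has_side_cosines_def by blast
  have "{p, q, r} = {a, b, c}"
    using corners_eq_vertices[OF x(1)] T(2) abc(1) unfolding x(2) by metis
  from side_cosines_cong[OF this] show ?thesis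
    using has_cornersD(1)[OF T(2)] has_cornersD(1)[OF abc(1)] abc(2) by simp
qed

lemma corner_angle_chamber:
  assumes "T \<in> chambers" "has_corners T v b c"
  shows "corner_angle v b c = opposite_angle M (b \<bullet> c)"
  using corner_angle_eq_opposite_angle[OF has_cornersD(1)[OF assms(2)]] side_cosines_eq[OF assms]
  by simp

lemma half_turn_pattern_triangles:
  assumes S: "\<And>i. S i \<in> chambers" "\<And>i. has_corners (S i) v (B i) (B (Suc i))"
    and angle: "\<And>i. corner_angle v (B i) (B (Suc i)) = f (Suc i) - f i"
    and half_turn: "\<And>i. f (i + n) = f i + pi" and "2 \<le> n"
  shows "half_turn_pattern M (opposite_angle M) n (\<lambda>i. v \<bullet> B i) (\<lambda>i. B i \<bullet> B (Suc i))"
proof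
  have sides: "side_cosines v (B i) (B (Suc i)) = M" for i by (rule side_cosines_eq[OF S])
  note triangle_angles = opposite_angle_side_cosines[OF has_cornersD(1)[OF S(2)] sides[symmetric]]
  have base_in_M: "B i \<bullet> B (Suc i) \<in># M" for i
    unfolding sides[of i, symmetric] by (simp add: side_cosines_def)
  have angle_base: "opposite_angle M (B i \<bullet> B (Suc i)) = f (Suc i) - f i" for i
    using angle[of i] corner_angle_chamber[OF S] by simp
  show "0 < opposite_angle M z" if "z \<in># M" for z by (rule triangle_angles(3)[OF that])
  show "pi < (\<Sum>z\<in>#M. opposite_angle M z)" by (rule triangle_angles(1))
  show "2 \<le> n" by (fact \<open>2 \<le> n\<close>)
  show "{#v \<bullet> B i, v \<bullet> B (Suc i), B i \<bullet> B (Suc i)#} = M" for i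
    using sides[of i] by (simp add: side_cosines_def add_mset_commute)
  show "B (i + n) \<bullet> B (Suc (i + n)) = B i \<bullet> B (Suc i)" for i
    using half_turn[of i] half_turn[of "Suc i"]
    by (intro inj_onD[OF triangle_angles(2) _ base_in_M base_in_M]) (simp add: angle_base)
  show "(\<Sum>i<n. opposite_angle M (B i \<bullet> B (Suc i))) = pi"
    using half_turn[of 0] by (simp add: angle_base sum_lessThan_telescope)
qed

lemma vertex_pattern:
  assumes v: "vertex v"
  obtains n leg base where "half_turn_pattern M (opposite_angle M) n leg base"
    "\<And>T. T \<in> chambers \<Longrightarrow> v \<in> T \<Longrightarrow> \<exists>i. has_angle_at T v (opposite_angle M (base i))"
proof -
  have "v \<noteq> 0" using v by (auto simp: vertex_def)
  then obtain e1 e2 where frame: "orthonormal_pair e1 e2" "span {e1, e2} = {w. v \<bullet> w = 0}"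
    by (rule tangent_plane_frame)
  interpret orthonormal_pair e1 e2 by (fact frame(1))
  interpret vertex_frame P v e1 e2
  proof unfold_locales
    fix x assume "generic x"
    then have "has_side_cosines (chamber x) M" by (simp add: chamber_side_cosines chambers_def)
    then show "spherical_triangle (chamber x)"
      by (auto simp: has_side_cosines_def has_corners_def spherical_triangle_def)
  qed (fact v frame(2))+
  obtain f n S B where n: "0 < n" and consec: "\<And>i. consecutive (f i) (f (Suc i))"
    and half_turn: "\<And>i. f (i + n) = f i + pi"
    and S: "\<And>i. sector (f i) (f (Suc i)) (S i) (B i) (B (Suc i))"
    and cover: "\<And>T. T \<in> chambers \<Longrightarrow> v \<in> T \<Longrightarrow> \<exists>i b c. sector (f i) (f (Suc i)) T b c"
    by (rule sector_sequence) blast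
  have corners: "S i \<in> chambers" "has_corners (S i) v (B i) (B (Suc i))" for i
    using S[of i] by (simp_all add: sector_def)
  have angle: "corner_angle v (B i) (B (Suc i)) = f (Suc i) - f i" for i
    by (rule sector_angle(1)[OF S consec])
  have "n \<noteq> 1" using sector_angle(2)[OF S consec, of 0] half_turn[of 0] by auto
  then have "2 \<le> n" using n by simp
  note half_turn_pattern_triangles[OF corners angle half_turn this]
  moreover have "has_angle_at T v (opposite_angle M (B i \<bullet> B (Suc i)))"
    if "sector (f i) (f (Suc i)) T b c" for i T b c
    using sector_angle(1)[OF that consec] angle[of i] corner_angle_chamber[OF corners] that
    unfolding has_angle_at_iff sector_def by metis
  ultimately show ?thesis using that cover by blast
qed

lemma angle_le_half_pi:
  assumes T: "T \<in> chambers" and z: "z \<in># M"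
  shows "opposite_angle M z \<le> pi / 2"
proof -
  obtain p q r where T': "has_corners T p q r" "z = q \<bullet> r"
  proof -
    obtain a b c where abc: "has_corners T a b c" "side_cosines a b c = M"
      using chamber_side_cosines[OF T] unfolding has_side_cosines_def by blast
    have "has_corners T b a c" "has_corners T c a b" using abc(1) has_corners_commute by blast+
    moreover have "z = b \<bullet> c \<or> z = a \<bullet> c \<or> z = a \<bullet> b"
      using z abc(2) by (auto simp: side_cosines_def)
    ultimately show ?thesis using that abc(1) by blast
  qed
  obtain x where x: "generic x" "T = chamber x" using T by (rule chambers_cases)
  have "vertex p" using corner_vertex[OF x(1)] T'(1) x(2) by blast
  then obtain n leg base where pattern: "half_turn_pattern M (opposite_angle M) n leg base"
    and cover: "\<And>T. T \<in> chambers \<Longrightarrow> p \<in> T \<Longrightarrow> \<exists>i. has_angle_at T p (opposite_angle M (base i))"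
    by (rule vertex_pattern) blast
  have "p \<in> T" using has_cornersD(3)[OF T'(1)] by simp
  then obtain i where "has_angle_at T p (opposite_angle M (base i))" using cover T by blast
  moreover have "has_angle_at T p (opposite_angle M z)"
    unfolding has_angle_at_iff using T' corner_angle_chamber[OF T T'(1)] by metis
  ultimately have "opposite_angle M z = opposite_angle M (base i)"
    using has_angle_at_unique by blast
  then show ?thesis using half_turn_pattern.angle_base_le[OF pattern] by simp
qed

lemma equal_angles_at_vertex:
  assumes v: "vertex v"
  shows "\<exists>\<alpha>. \<forall>T\<in>chambers. v \<in> T \<longrightarrow> has_angle_at T v \<alpha>"
proof (cases "chambers = {}")
  case False
  obtain n leg base where pattern: "half_turn_pattern M (opposite_angle M) n leg base"
    and cover: "\<And>T. T \<in> chambers \<Longrightarrow> v \<in> T \<Longrightarrow> \<exists>i. has_angle_at T v (opposite_angle M (base i))"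
    by (rule vertex_pattern[OF v]) blast
  have "base i = base 0" for i
    using half_turn_pattern.base_constant[OF pattern] angle_le_half_pi False by blast
  then show ?thesis using cover by metis
qed simp

end

lemma congruent_triangles_side_cosines:
  assumes "\<forall>T\<in>\<T>. spherical_triangle T" "\<forall>S\<in>\<T>. \<forall>T\<in>\<T>. sphere_congruent S T"
  obtains M where "\<And>T. T \<in> \<T> \<Longrightarrow> has_side_cosines T M"
proof (cases "\<T> = {}")
  case False
  then obtain S where S: "S \<in> \<T>" by blast
  then obtain a b c where "has_corners S a b c"
    using assms(1) unfolding spherical_triangle_def has_corners_def by blast
  then have "has_side_cosines S (side_cosines a b c)" unfolding has_side_cosines_def by blast
  then show ?thesis using that sphere_congruent_has_side_cosines assms(2) S by blast
qed (use that in simp)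

theorem theorem3p1:
  fixes \<C> :: "(real ^ 3) set set" and v :: "real ^ 3"
  assumes "finite \<C>"
    and "\<forall>C \<in> \<C>. great_circle C"
    and "\<forall>T \<in> cells \<C>. spherical_triangle T"
    and "\<forall>S \<in> cells \<C>. \<forall>T \<in> cells \<C>. sphere_congruent S T"
    and "\<exists>C \<in> \<C>. \<exists>D \<in> \<C>. C \<noteq> D \<and> v \<in> C \<and> v \<in> D"
  shows "\<exists>\<alpha>. \<forall>T \<in> cells \<C>. v \<in> T \<longrightarrow> has_angle_at T v \<alpha>"
proof -
  obtain N where N: "\<And>C. C \<in> \<C> \<Longrightarrow> N C \<noteq> 0 \<and> {x \<in> sphere 0 1. N C \<bullet> x = 0} = C"
    using assms(2) unfolding great_circle_def by metis
  then have on_circle: "x \<in> C \<longleftrightarrow> x \<in> sphere 0 1 \<and> N C \<bullet> x = 0" if "C \<in> \<C>" for C x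
    using that by blast
  obtain C D where CD: "C \<in> \<C>" "D \<in> \<C>" "C \<noteq> D" "v \<in> C" "v \<in> D" using assms(5) by blast
  interpret great_circle_arrangement "N ` \<C>"
    using assms(1) CD(1) N by unfold_locales auto
  have "sphere 0 1 - \<Union>\<C> = {x \<in> sphere 0 1. generic x}"
    using on_circle by (auto simp: generic_def)
  then have cells: "cells \<C> = chambers" by (simp only: cells_def closure_components_generic)
  have "vertex v"
    using vertex_if_on_two_circles[of "N C" "N D" v] N CD on_circle by simp
  obtain M where "\<And>T. T \<in> chambers \<Longrightarrow> has_side_cosines T M"
    using congruent_triangles_side_cosines[OF assms(3,4)] unfolding cells by blast
  then interpret congruent_arrangement "N ` \<C>" M by unfold_locales
  show ?thesis unfolding cells by (rule equal_angles_at_vertex[OF \<open>vertex v\<close>])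
qed

end
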